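(* There is a universal constant $c>0$ (independent of $n,d,k,\sigma,R$ and of the design matrix) such that the following holds. Let $\sigma>0$, let $n,d$ be integers with $d\ge n\ge 4$, let $k\ge 2$ be an integer, and let $R\ge 8\sigma/\sqrt n$. Then there is a design matrix $X\in\mathbb{R}^{n\times d}$ satisfying the column normalization condition $\|X_j\|_2/\sqrt n\le 1$ for every column $X_j$, $j=1,\dots,d$, such that for every coordinate-separable penalty $\rho\in\mathcal{F}$, $$\sup_{\theta^*\in\mathbb{B}_0(k)\cap\mathbb{B}_1(R)}\ \mathbb{E}\Big[\inf_{\lambda\ge 0}\ \sup_{\theta\in\widehat\Theta_\lambda}\ \tfrac1n\|X(\theta-\theta^* )\|_2^2\Big]\ \ge\ c\,\min\Big\{\sigma^2,\frac{\sigma R}{\sqrt n}\Big\}.$$ Moreover, for every convex coordinate-separable penalty $\rho\in\mathcal{F}$, $$\sup_{\theta^*\in\mathbb{B}_0(k)\cap\mathbb{B}_1(R)}\ \mathbb{E}\Big[\inf_{\lambda\ge 0}\ \inf_{\theta\in\widehat\Theta_\lambda}\ \tfrac1n\|X(\theta-\theta^* )\|_2^2\Big]\ \ge\ c\,\min\Big\{\sigma^2,\frac{\sigma R}{\sqrt n}\Big\}.$$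
   Context: Model: $y=X\theta^*+w\in\mathbb{R}^n$, where $X\in\mathbb{R}^{n\times d}$ is deterministic and $w$ has i.i.d. $N(0,\sigma^2)$ entries; the expectation is over $w$. $\mathbb{B}_0(k)\subset\mathbb{R}^d$ is the set of vectors with at most $k$ non-zero entries; $\mathbb{B}_1(R)=\{\theta\in\mathbb{R}^d:\|\theta\|_1\le R\}$. The family $\mathcal{F}$ of coordinate-separable penalties consists of the functions $\rho:\mathbb{R}^d\to\mathbb{R}$ such that: (i) $\rho(\theta)=\sum_{j=1}^d\rho_j(\theta_j)$ for some univariate functions $\rho_j:\mathbb{R}\to\mathbb{R}$; (ii) each $\rho_j$ satisfies $\rho_j(0)=0$ and $\rho_j(t)=\rho_j(-t)$ for all $t\in\mathbb{R}$; (iii) each $\rho_j$ is nondecreasing on $[0,+\infty)$. For $\lambda\ge0$ let $L(\theta;\lambda)=\frac1n\|y-X\theta\|_2^2+\lambda\rho(\theta)$. A vector $\tilde\theta$ is a local minimum of $\theta\mapsto L(\theta;\lambda)$ if there is an open ball $\mathbb{B}$ centered at $\tilde\theta$ with $\tilde\theta\in\arg\min_{\theta\in\mathbb{B}}L(\theta;\lambda)$. $\widehat\Theta_\lambda$ is the set of all local minima of $\theta\mapsto L(\theta;\lambda)$; it depends on $(X,y,\rho)$ and $\lambda$.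
   Formalization: The first claim is stated only for lower semicontinuous ρ in F; otherwise local minima may not exist and it fails (with sup over the empty set 0), e.g. for ρ_j(t)=0 if |t|<e and 1+|t|−e otherwise, with e small. The second claim is unchanged. *)

theory Defs
  imports "HOL-Probability.Probability" "Jordan_Normal_Form.Matrix"
begin

text \<open>
  The dimensions \<open>n\<close> and \<open>d\<close> are quantified inside the scope of the universal constant, so
  vectors and matrices are carrier-based: \<open>\<real>\<^sup>d\<close> is \<^term>\<open>carrier_vec d\<close>, and the design
  lies in \<^term>\<open>carrier_mat n d\<close>.
\<close>

definition l1_norm :: "real Matrix.vec \<Rightarrow> real" where
  "l1_norm v = (\<Sum>i<dim_vec v. \<bar>vec_index v i\<bar>)"

definition l2_norm :: "real Matrix.vec \<Rightarrow> real" where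
  "l2_norm v = L2_set (vec_index v) {..<dim_vec v}"

definition open_ball :: "nat \<Rightarrow> real Matrix.vec \<Rightarrow> real \<Rightarrow> real Matrix.vec set" where
  "open_ball d u r = {v \<in> carrier_vec d. l2_norm (v - u) < r}"

definition B0 :: "nat \<Rightarrow> nat \<Rightarrow> real Matrix.vec set" where
  "B0 d k = {v \<in> carrier_vec d. card {j. j < d \<and> vec_index v j \<noteq> 0} \<le> k}"

definition B1 :: "nat \<Rightarrow> real \<Rightarrow> real Matrix.vec set" where
  "B1 d R = {v \<in> carrier_vec d. l1_norm v \<le> R}"

definition separable_penalties :: "nat \<Rightarrow> (real Matrix.vec \<Rightarrow> real) set" where
  "separable_penalties d = {\<rho>. \<exists>\<rho>j :: nat \<Rightarrow> real \<Rightarrow> real.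
     (\<forall>\<theta>\<in>carrier_vec d. \<rho> \<theta> = (\<Sum>j<d. \<rho>j j (vec_index \<theta> j))) \<and>
     (\<forall>j<d. \<rho>j j 0 = 0 \<and> (\<forall>t. \<rho>j j t = \<rho>j j (- t)) \<and> mono_on {0..} (\<rho>j j))}"

definition convex_penalty :: "nat \<Rightarrow> (real Matrix.vec \<Rightarrow> real) \<Rightarrow> bool" where
  "convex_penalty d \<rho> \<longleftrightarrow> (\<forall>u\<in>carrier_vec d. \<forall>v\<in>carrier_vec d. \<forall>t\<in>{0..1}.
     \<rho> (t \<cdot>\<^sub>v u + (1 - t) \<cdot>\<^sub>v v) \<le> t * \<rho> u + (1 - t) * \<rho> v)"

text \<open>
  Members of the family may be discontinuous, and without lower semicontinuity the objective need
  not attain its minimum on a closed ball, nor have any local minimum at all.  The usual penalties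
  (\<open>\<ell>\<^sub>q\<close> for \<open>q \<ge> 0\<close>, SCAD, MCP, and every convex penalty) are lower semicontinuous.
\<close>

definition lsc_penalty :: "nat \<Rightarrow> (real Matrix.vec \<Rightarrow> real) \<Rightarrow> bool" where
  "lsc_penalty d \<rho> \<longleftrightarrow> (\<forall>u\<in>carrier_vec d. \<forall>\<epsilon>>0. \<exists>r>0. \<forall>v\<in>open_ball d u r. \<rho> u - \<epsilon> < \<rho> v)"

definition objective ::
  "real mat \<Rightarrow> real Matrix.vec \<Rightarrow> (real Matrix.vec \<Rightarrow> real) \<Rightarrow> real \<Rightarrow> real Matrix.vec \<Rightarrow> real" where
  "objective X y \<rho> lam \<theta> = (l2_norm (y - X *\<^sub>v \<theta>))\<^sup>2 / real (dim_row X) + lam * \<rho> \<theta>"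

definition local_minima ::
  "real mat \<Rightarrow> real Matrix.vec \<Rightarrow> (real Matrix.vec \<Rightarrow> real) \<Rightarrow> real \<Rightarrow> real Matrix.vec set" where
  "local_minima X y \<rho> lam = {\<theta> \<in> carrier_vec (dim_col X).
     \<exists>r>0. \<forall>\<theta>'\<in>open_ball (dim_col X) \<theta> r. objective X y \<rho> lam \<theta> \<le> objective X y \<rho> lam \<theta>'}"

definition prediction_error :: "real mat \<Rightarrow> real Matrix.vec \<Rightarrow> real Matrix.vec \<Rightarrow> real" where
  "prediction_error X \<theta>s \<theta> = (l2_norm (X *\<^sub>v (\<theta> - \<theta>s)))\<^sup>2 / real (dim_row X)"

definition gaussian_noise :: "nat \<Rightarrow> real \<Rightarrow> (nat \<Rightarrow> real) measure" where
  "gaussian_noise n \<sigma> = (\<Pi>\<^sub>M i\<in>{..<n}. density lborel (\<lambda>x. ennreal (normal_density 0 \<sigma> x)))"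

definition response :: "real mat \<Rightarrow> real Matrix.vec \<Rightarrow> (nat \<Rightarrow> real) \<Rightarrow> real Matrix.vec" where
  "response X \<theta>s w = X *\<^sub>v \<theta>s + Matrix.vec (dim_row X) w"

text \<open>
  Suprema, infima and expectations are taken in \<open>[0, \<infinity>]\<close>, where \<open>Sup {} = 0\<close> and
  \<open>Inf {} = \<infinity>\<close>.  The integrand need not be measurable; the nonnegative integral is then the
  lower integral, so a lower bound for it is the strongest reading.
\<close>

definition worst_local_risk ::
  "real mat \<Rightarrow> real \<Rightarrow> (real Matrix.vec \<Rightarrow> real) \<Rightarrow> real Matrix.vec \<Rightarrow> ennreal" where
  "worst_local_risk X \<sigma> \<rho> \<theta>s =
     (\<integral>\<^sup>+ w. (INF lam\<in>{0..}. SUP \<theta>\<in>local_minima X (response X \<theta>s w) \<rho> lam.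
        ennreal (prediction_error X \<theta>s \<theta>)) \<partial>gaussian_noise (dim_row X) \<sigma>)"

definition best_local_risk ::
  "real mat \<Rightarrow> real \<Rightarrow> (real Matrix.vec \<Rightarrow> real) \<Rightarrow> real Matrix.vec \<Rightarrow> ennreal" where
  "best_local_risk X \<sigma> \<rho> \<theta>s =
     (\<integral>\<^sup>+ w. (INF lam\<in>{0..}. INF \<theta>\<in>local_minima X (response X \<theta>s w) \<rho> lam.
        ennreal (prediction_error X \<theta>s \<theta>)) \<partial>gaussian_noise (dim_row X) \<sigma>)"

end

theory Submission
  imports Defs
begin

text \<open>
  With \<open>\<delta> = \<sigma> / sqrt n\<close> and \<open>s\<^sup>2 = \<delta> / R\<close>, the design consists of \<open>n div 2\<close> diagonal blocks
  \<open>sqrt n * [[c, -c], [s, s]]\<close>, whose two columns are nearly opposite.  The signal \<open>(R/2, R/2)\<close> in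
  one block moves the gradient at \<open>0\<close> only by the size of the noise, although omitting it costs
  \<open>s\<^sup>2 R\<^sup>2 = R \<delta>\<close>.  Place it in the block whose penalty at \<open>\<delta>\<close> is largest.  If \<open>\<lambda>\<close> times this
  penalty is at least \<open>11 \<delta>\<^sup>2\<close>, some local minimum (every one, for convex penalties) keeps a
  coordinate of the signal block below \<open>\<delta>\<close> and misses the signal.  Otherwise the penalty is
  negligible at \<open>\<delta>\<close> in every block, and each null block whose noise falls into a fixed window is
  fitted with error of order \<open>\<delta>\<^sup>2\<close>; these errors add up to order \<open>\<sigma>\<^sup>2\<close>.
\<close>

section \<open>One two-dimensional block\<close>

text \<open>The infimum over \<lambda> sits inside the expectation, so \<lambda> may be tuned to the
  noise and to the signal. The dichotomy is therefore deterministic: for one and the same noise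
  vector both regimes of \<lambda> are bad. The design precedes the penalty while the signal may
  follow it, so the blocks are identical and the choice among them stays open until \<rho> is known.
  A penalty may be nonconvex and have jumps, so stationarity conditions are out of reach; values are
  compared at explicit points.

  Constants: in the signal block |p| \<le> \<delta> and s |q| \<le> 2 \<delta>, so zeroing a
  coordinate x, with its partner readjusted, loses at most 10 \<delta> |x| of fit, and a penalty of
  11 \<delta> |x| outweighs this. R \<ge> 8 \<delta> makes a coordinate of size \<delta> useless for
  the signal and gives s^2 \<le> 1/8, hence c \<ge> 7/8. In a null block with p between 10 \<delta>
  and 11 \<delta>, the point (\<delta>, -\<delta>) gains at least 31 \<delta>^2 of fit for a penalty
  below 22 \<delta>^2, while a point of error below \<delta>^2/16 gains at most 6
  \<delta>^2.\<close>

definition block_fit :: "real \<Rightarrow> real \<Rightarrow> real \<Rightarrow> real \<Rightarrow> real \<Rightarrow> real \<Rightarrow> real" where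
  "block_fit c s p q x y = (c * (x - y) - p)\<^sup>2 + (s * (x + y) - q)\<^sup>2"

definition even_mono :: "(real \<Rightarrow> real) \<Rightarrow> bool" where
  "even_mono f \<longleftrightarrow> f 0 = 0 \<and> (\<forall>t. f t = f (- t)) \<and> mono_on {0..} f"

lemma even_mono_le:
  assumes "even_mono f" "\<bar>x\<bar> \<le> \<bar>y\<bar>"
  shows "f x \<le> f y"
proof -
  have abs: "f t = f \<bar>t\<bar>" for t
    using assms(1) by (cases "t \<ge> 0") (auto simp: even_mono_def)
  have "f \<bar>x\<bar> \<le> f \<bar>y\<bar>"
    using assms by (auto simp: even_mono_def mono_on_def)
  then show ?thesis using abs by metis
qed

lemma even_mono_nonneg: "even_mono f \<Longrightarrow> 0 \<le> f x"
  using even_mono_le[of f 0 x] by (auto simp: even_mono_def)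

lemma even_mono_scale: "even_mono f \<Longrightarrow> 0 \<le> a \<Longrightarrow> even_mono (\<lambda>x. a * f x)"
  unfolding even_mono_def mono_on_def by (auto intro!: mult_left_mono)

lemma block_fit_zero_pos:
  assumes cs: "0 \<le> s" "s \<le> c" "c\<^sup>2 + s\<^sup>2 = 1" and t: "0 \<le> t"
  shows "\<exists>y'. \<bar>y'\<bar> \<le> \<bar>y\<bar> \<and>
    block_fit c s p q 0 y' \<le> block_fit c s p q t y + t * (2 * \<bar>p\<bar> + 4 * (s * \<bar>q\<bar>))"
proof -
  have c1: "c \<le> 1" using cs by (metis abs_square_le_1 abs_le_D1 le_add_same_cancel1 zero_le_power2)
  have c0: "0 \<le> c" using cs by simp
  have qs: "s * q \<le> s * \<bar>q\<bar>" "0 \<le> s * \<bar>q\<bar>" using cs by (auto intro: mult_left_mono)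
  have cp: "c * p \<le> \<bar>p\<bar>"
  proof -
    have "c * p \<le> c * \<bar>p\<bar>" using c0 by (intro mult_left_mono) auto
    also have "\<dots> \<le> 1 * \<bar>p\<bar>" using c1 by (intro mult_right_mono) auto
    finally show ?thesis by simp
  qed
  consider "y \<ge> t" | "0 \<le> y" "y \<le> t" | "y < 0" by linarith
  then show ?thesis
  proof cases
    \<comment> \<open>At \<open>(0, y - t)\<close> the sum of the coordinates has dropped by 2 t,
      and the quadratic leftover \<open>- 4 * (t * (s\<^sup>2 * y))\<close> has the favourable
      sign.\<close>
    case 1
    have "block_fit c s p q 0 (y - t) - block_fit c s p q t y = t * (4 * (s * q)) - 4 * (t * (s\<^sup>2 * y))"
      unfolding block_fit_def by (simp add: power2_eq_square algebra_simps)
    also have "\<dots> \<le> t * (4 * (s * \<bar>q\<bar>)) - 0"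
      using 1 t qs cs(1) by (intro diff_mono mult_left_mono) auto
    also have "\<dots> \<le> t * (2 * \<bar>p\<bar> + 4 * (s * \<bar>q\<bar>))"
      using t by (simp add: algebra_simps)
    finally show ?thesis using 1 t by (intro exI[of _ "y - t"]) auto
  next
    \<comment> \<open>Subtracting t would make the partner negative and possibly larger in modulus,
      which its penalty forbids; the origin serves instead.\<close>
    case 2
    have "block_fit c s p q 0 0 - block_fit c s p q t y
        = 2 * ((t - y) * (c * p)) + 2 * ((t + y) * (s * q)) - (c * (t - y))\<^sup>2 - (s * (t + y))\<^sup>2"
      unfolding block_fit_def by (simp add: power2_eq_square algebra_simps)
    also have "\<dots> \<le> 2 * ((t - y) * (c * p)) + 2 * ((t + y) * (s * q))" by simp
    also have "\<dots> \<le> 2 * (t * \<bar>p\<bar>) + 2 * ((2 * t) * (s * \<bar>q\<bar>))"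
    proof (intro add_mono mult_left_mono)
      have "(t - y) * (c * p) \<le> (t - y) * \<bar>p\<bar>" using 2 cp by (intro mult_left_mono) auto
      also have "\<dots> \<le> t * \<bar>p\<bar>" using 2 by (intro mult_right_mono) auto
      finally show "(t - y) * (c * p) \<le> t * \<bar>p\<bar>" .
      have "(t + y) * (s * q) \<le> (t + y) * (s * \<bar>q\<bar>)" using 2 qs t cs(1) by (intro mult_left_mono) auto
      also have "\<dots> \<le> (2 * t) * (s * \<bar>q\<bar>)" using 2 qs cs(1) by (intro mult_right_mono) auto
      finally show "(t + y) * (s * q) \<le> (2 * t) * (s * \<bar>q\<bar>)" .
    qed auto
    finally show ?thesis by (intro exI[of _ 0]) (auto simp: algebra_simps)
  next
    \<comment> \<open>For opposite signs the partner stays put: the cross term has the factor t y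
      \<le> 0, and \<open>s \<le> c\<close> makes its coefficient nonnegative.\<close>
    case 3
    have "block_fit c s p q 0 y - block_fit c s p q t y
        = - ((c\<^sup>2 + s\<^sup>2) * t\<^sup>2) + 2 * (t * y) * (c\<^sup>2 - s\<^sup>2) + 2 * (t * (c * p)) + 2 * (t * (s * q))"
      unfolding block_fit_def by (simp add: power2_eq_square algebra_simps)
    also have "\<dots> \<le> 0 + 0 + 2 * (t * \<bar>p\<bar>) + 2 * (t * (s * \<bar>q\<bar>))"
    proof (intro add_mono mult_left_mono)
      have "s\<^sup>2 \<le> c\<^sup>2" using cs by (intro power_mono) auto
      moreover have "t * y \<le> 0" using 3 t by (intro mult_nonneg_nonpos) auto
      ultimately show "2 * (t * y) * (c\<^sup>2 - s\<^sup>2) \<le> 0" by (simp add: mult_nonpos_nonneg)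
    qed (use cs cp qs t in \<open>auto intro: mult_left_mono\<close>)
    also have "\<dots> \<le> t * (2 * \<bar>p\<bar> + 4 * (s * \<bar>q\<bar>))"
      using mult_nonneg_nonneg[OF t qs(2)] by (simp add: algebra_simps)
    finally show ?thesis by (intro exI[of _ y]) auto
  qed
qed

lemma block_fit_minus: "block_fit c s (- p) (- q) (- x) (- y) = block_fit c s p q x y"
  unfolding block_fit_def by (simp add: power2_eq_square algebra_simps)

text \<open>Exchanging the two coordinates amounts to a sign change of p, so whatever is shown for
  the first coordinate transfers to the second.\<close>

lemma block_fit_swap: "block_fit c s (- p) q y x = block_fit c s p q x y"
  unfolding block_fit_def by (simp add: power2_eq_square algebra_simps)

text \<open>
  Zeroing one coordinate costs only an amount linear in that coordinate, uniformly in the other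
  one: the partner coordinate is moved along, so that the well-conditioned direction \<open>x - y\<close>
  is not disturbed.
\<close>

lemma block_fit_zero:
  assumes cs: "0 \<le> s" "s \<le> c" "c\<^sup>2 + s\<^sup>2 = 1"
  obtains y' where "\<bar>y'\<bar> \<le> \<bar>y\<bar>"
    "block_fit c s p q 0 y' \<le> block_fit c s p q t y + \<bar>t\<bar> * (2 * \<bar>p\<bar> + 4 * (s * \<bar>q\<bar>))"
proof (cases "t \<ge> 0")
  case True
  then show ?thesis using block_fit_zero_pos[OF cs True, of y p q] that by auto
next
  case False
  then obtain y' where "\<bar>y'\<bar> \<le> \<bar>- y\<bar>" "block_fit c s (- p) (- q) 0 y'
      \<le> block_fit c s (- p) (- q) (- t) (- y) + \<bar>t\<bar> * (2 * \<bar>p\<bar> + 4 * (s * \<bar>q\<bar>))"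
    using block_fit_zero_pos[OF cs, of "- t" "- y" "- p" "- q"] by auto
  then show ?thesis
    using that[of "- y'"] block_fit_minus[of c s p q t y] block_fit_minus[of c s p q 0 "- y'"] by simp
qed

section \<open>Lower semicontinuous functions and attained minima\<close>

definition lsc :: "('a::topological_space \<Rightarrow> real) \<Rightarrow> bool" where
  "lsc f \<longleftrightarrow> (\<forall>a. open {x. a < f x})"

text \<open>Without a minimizer the open sets \<open>{x. f y < f x}\<close> cover S; in a finite
  subcover the index with the least value is itself left uncovered.\<close>

lemma lsc_attains_inf:
  assumes "lsc f" "compact S" "S \<noteq> {}"
  shows "\<exists>x\<in>S. \<forall>y\<in>S. f x \<le> f y"
proof (rule ccontr)
  assume *: "\<not> ?thesis"
  have "\<exists>y\<in>S. f y < f x" if "x \<in> S" for x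
    using * that by (meson not_le)
  then have "S \<subseteq> (\<Union>y\<in>S. {x. f y < f x})" by blast
  moreover have "open {x. f y < f x}" for y using assms(1) by (simp add: lsc_def)
  ultimately obtain C where C: "C \<subseteq> S" "finite C" "S \<subseteq> (\<Union>y\<in>C. {x. f y < f x})"
    using compactE_image[OF assms(2), of S "\<lambda>y. {x. f y < f x}"] by auto
  then have "C \<noteq> {}" using assms(3) by auto
  then obtain y where y: "y \<in> C" "\<And>z. z \<in> C \<Longrightarrow> f y \<le> f z"
    using C(2) by (metis arg_min_if_finite(1) arg_min_least)
  then show False using C(1,3) by force
qed

lemma lsc_continuous:
  fixes f :: "'a::topological_space \<Rightarrow> real"
  assumes "continuous_on UNIV f" shows "lsc f"
  unfolding lsc_def using assms by (auto intro!: open_Collect_less continuous_on_const)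

lemma lsc_add:
  assumes "lsc f" "lsc g" shows "lsc (\<lambda>x. f x + g x)"
proof -
  have "{x. a < f x + g x} = (\<Union>b. {x. b < f x} \<inter> {x. a - b < g x})" for a
  proof safe
    fix x assume "a < f x + g x"
    then show "x \<in> (\<Union>b. {x. b < f x} \<inter> {x. a - b < g x})"
      \<comment> \<open>The threshold b gives half of the slack to each summand.\<close>
      by (intro UN_I[of "f x - (f x + g x - a) / 2"]) (auto simp: field_simps)
  next
    fix x b assume "b < f x" "a - b < g x"
    then show "a < f x + g x" by simp
  qed
  then show ?thesis using assms unfolding lsc_def by (auto intro!: open_UN)
qed

lemma lsc_compose:
  assumes "lsc f" "continuous_on UNIV h" shows "lsc (\<lambda>x. f (h x))"
proof -
  have "open (h -` {x. a < f x})" for a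
    using assms unfolding lsc_def by (intro open_vimage) auto
  then show ?thesis unfolding lsc_def by (simp add: vimage_def)
qed

lemma lsc_scale:
  assumes "lsc f" "0 \<le> a" shows "lsc (\<lambda>x. a * f x)"
proof (cases "a = 0")
  case True
  then show ?thesis by (simp add: lsc_continuous)
next
  case False
  have "{x. b < a * f x} = {x. b / a < f x}" for b using False assms by (auto simp: field_simps)
  then show ?thesis using assms(1) unfolding lsc_def by simp
qed

lemma abs_bound_of_sq:
  fixes z p q :: real
  assumes a: "(z - p)\<^sup>2 \<le> p\<^sup>2 + q\<^sup>2"
  shows "\<bar>z\<bar> \<le> 2 * (\<bar>p\<bar> + \<bar>q\<bar>)"
proof -
  have "p\<^sup>2 + q\<^sup>2 \<le> (\<bar>p\<bar> + \<bar>q\<bar>)\<^sup>2" by (simp add: power2_sum)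
  with a have "\<bar>z - p\<bar>\<^sup>2 \<le> (\<bar>p\<bar> + \<bar>q\<bar>)\<^sup>2" by simp
  then have "\<bar>z - p\<bar> \<le> \<bar>p\<bar> + \<bar>q\<bar>" by (rule power2_le_imp_le) simp
  moreover have "\<bar>z\<bar> \<le> \<bar>z - p\<bar> + \<bar>p\<bar>" using abs_triangle_ineq[of "z - p" p] by simp
  ultimately show ?thesis using abs_ge_zero[of q] unfolding distrib_left by linarith
qed

text \<open>Coercivity: a point no worse than the origin has fit at most p^2 + q^2, which bounds
  both x - y and x + y because c and s are positive. The closed region T is there to cover the whole
  plane as well as a strip around x = 0.\<close>

lemma block_min_exists:
  assumes cs: "0 < s" "0 < c" and em: "even_mono f" "even_mono g" and l: "lsc f" "lsc g"
    and T: "closed T" "(0, 0) \<in> T"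
  obtains x y where "(x, y) \<in> T"
    "\<And>x' y'. (x', y') \<in> T \<Longrightarrow> block_fit c s p q x y + f x + g y \<le> block_fit c s p q x' y' + f x' + g y'"
proof -
  define F where "F = (\<lambda>z. block_fit c s p q (fst z) (snd z) + f (fst z) + g (snd z))"
  define B where "B = 2 * (\<bar>p\<bar> + \<bar>q\<bar>) / c + 2 * (\<bar>p\<bar> + \<bar>q\<bar>) / s"
  define S where "S = T \<inter> cbox (- B, - B) (B, B)"
  have B0: "0 \<le> B" using cs by (auto simp: B_def)
  have "lsc F" unfolding F_def block_fit_def
    by (intro lsc_add lsc_compose[OF l(1)] lsc_compose[OF l(2)] lsc_continuous continuous_intros)
  moreover have "compact S" unfolding S_def using T by (intro closed_Int_compact) auto
  moreover have z0: "(0, 0) \<in> S" using T B0 by (auto simp: S_def)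
  ultimately obtain z where z: "z \<in> S" "\<And>z'. z' \<in> S \<Longrightarrow> F z \<le> F z'"
    using lsc_attains_inf[of F S] by blast
  have F0: "F (0, 0) = p\<^sup>2 + q\<^sup>2"
    using em by (simp add: F_def block_fit_def even_mono_def power2_eq_square)
  have "F z \<le> F (x', y')" if T': "(x', y') \<in> T" for x' y'
  proof (cases "(x', y') \<in> S")
    case True then show ?thesis using z by blast
  next
    case False
    have "F (0, 0) < F (x', y')"
    proof (rule ccontr)
      assume "\<not> ?thesis"
      then have le: "block_fit c s p q x' y' \<le> p\<^sup>2 + q\<^sup>2"
        using F0 even_mono_nonneg[OF em(1), of x'] even_mono_nonneg[OF em(2), of y'] by (simp add: F_def)
      have "\<bar>c * (x' - y')\<bar> \<le> 2 * (\<bar>p\<bar> + \<bar>q\<bar>)"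
        using le zero_le_power2[of "s * (x' + y') - q"] unfolding block_fit_def
        by (intro abs_bound_of_sq) linarith
      then have 1: "\<bar>x' - y'\<bar> \<le> 2 * (\<bar>p\<bar> + \<bar>q\<bar>) / c" using cs by (simp only: abs_mult abs_of_pos pos_le_divide_eq mult.commute[of _ c])
      have "\<bar>s * (x' + y')\<bar> \<le> 2 * (\<bar>q\<bar> + \<bar>p\<bar>)"
        using le zero_le_power2[of "c * (x' - y') - p"] unfolding block_fit_def
        by (intro abs_bound_of_sq) linarith
      then have 2: "\<bar>x' + y'\<bar> \<le> 2 * (\<bar>p\<bar> + \<bar>q\<bar>) / s" using cs by (simp only: abs_mult abs_of_pos pos_le_divide_eq mult.commute[of _ s] add.commute[of "\<bar>q\<bar>"])
      from 1 2 have "\<bar>x'\<bar> \<le> B" "\<bar>y'\<bar> \<le> B" unfolding B_def by linarith+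
      then have "(x', y') \<in> S" using T' by (auto simp: S_def)
      with False show False by simp
    qed
    moreover have "F z \<le> F (0, 0)" using z z0 by blast
    ultimately show ?thesis by simp
  qed
  then show ?thesis using that[of "fst z" "snd z"] z(1) by (auto simp: S_def F_def)
qed

section \<open>The block that carries the signal\<close>

lemma block_error_of_small:
  fixes c s x y R :: real
  assumes cs: "0 \<le> s" "s \<le> c" and x: "8 * \<bar>x\<bar> \<le> R" and R: "0 \<le> R"
  shows "9 / 32 * (s\<^sup>2 * R\<^sup>2) \<le> (c * (x - y))\<^sup>2 + (s * (x + y - R))\<^sup>2"
proof -
  let ?u = "c * \<bar>x - y\<bar>" let ?v = "s * \<bar>x + y - R\<bar>"
  \<comment> \<open>Since 2 x - R is the sum of x - y and x + y - R, a small x forces one of the two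
    errors to be of order R. Squaring 3/4 and halving, by (u + v)^2 \<le> 2 (u^2 + v^2), gives
    9/32.\<close>
  have "3 / 4 * R \<le> \<bar>2 * x - R\<bar>" using x by linarith
  also have "\<dots> \<le> \<bar>x - y\<bar> + \<bar>x + y - R\<bar>" by linarith
  finally have "s * (3 / 4 * R) \<le> s * (\<bar>x - y\<bar> + \<bar>x + y - R\<bar>)" using cs by (intro mult_left_mono)
  also have "\<dots> \<le> ?u + ?v" using cs by (simp add: algebra_simps mult_right_mono)
  finally have "(s * (3 / 4 * R))\<^sup>2 \<le> (?u + ?v)\<^sup>2" using cs R by (intro power_mono) auto
  also have "\<dots> \<le> 2 * (?u\<^sup>2 + ?v\<^sup>2)"
    using zero_le_power2[of "?u - ?v"] by (simp add: power2_sum power2_diff)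
  finally show ?thesis by (simp add: power_mult_distrib power_divide)
qed

text \<open>Square neighbourhoods instead of discs: the two coordinates can then be bounded
  separately when passing to and from Euclidean balls around the full vector.\<close>

definition block_local_min :: "(real \<Rightarrow> real \<Rightarrow> real) \<Rightarrow> real \<Rightarrow> real \<Rightarrow> bool" where
  "block_local_min F x y \<longleftrightarrow> (\<exists>r>0. \<forall>x' y'. \<bar>x' - x\<bar> < r \<longrightarrow> \<bar>y' - y\<bar> < r \<longrightarrow> F x y \<le> F x' y')"

text \<open>The assumption concerns the ratio of \<open>f x\<close> to |x|. It is met at |x| =
  \<delta> by monotonicity alone, and for all larger |x| under convexity; these are its two
  uses.\<close>

lemma penalized_coordinate_small:
  assumes cs: "0 < s" "s \<le> c" "c\<^sup>2 + s\<^sup>2 = 1" and em: "even_mono f" "even_mono g"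
    and \<delta>: "0 < \<delta>" and pq: "\<bar>p\<bar> \<le> \<delta>" "s * \<bar>q\<bar> \<le> 2 * \<delta>"
    and ft: "11 * \<delta> * \<bar>x\<bar> \<le> f x" "x \<noteq> 0"
  obtains y' where "block_fit c s p q 0 y' + f 0 + g y' < block_fit c s p q x y + f x + g y"
proof -
  have 0: "0 \<le> s" using cs by simp
  obtain y' where y': "\<bar>y'\<bar> \<le> \<bar>y\<bar>"
    "block_fit c s p q 0 y' \<le> block_fit c s p q x y + \<bar>x\<bar> * (2 * \<bar>p\<bar> + 4 * (s * \<bar>q\<bar>))"
    using block_fit_zero[OF 0 cs(2,3), of y p q x] by blast
  have "\<bar>x\<bar> * (2 * \<bar>p\<bar> + 4 * (s * \<bar>q\<bar>)) \<le> \<bar>x\<bar> * (10 * \<delta>)" using pq by (intro mult_left_mono) auto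
  also have "\<dots> < 11 * \<delta> * \<bar>x\<bar>" using \<delta> ft(2) by simp
  finally have "block_fit c s p q 0 y' + f 0 + g y' < block_fit c s p q x y + f x + g y"
    using y' ft(1) even_mono_le[OF em(2) y'(1)] em(1) by (simp add: even_mono_def)
  then show ?thesis using that by blast
qed

text \<open>A barrier argument: minimize over the strip |x| \<le> \<delta>. On its boundary the
  penalty is already so large that zeroing x, which stays in the strip, strictly improves the value.
  The minimizer is thus interior and hence a local minimum of the unconstrained problem, even if
  better points lie outside the strip.\<close>

lemma signal_block_local_min_aux:
  assumes cs: "0 < s" "s \<le> c" "c\<^sup>2 + s\<^sup>2 = 1" and em: "even_mono f" "even_mono g" and l: "lsc f" "lsc g"
    and \<delta>: "0 < \<delta>" "8 * \<delta> \<le> R" and pq: "\<bar>p\<bar> \<le> \<delta>" "s * \<bar>q\<bar> \<le> 2 * \<delta>"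
    and ft: "11 * \<delta>\<^sup>2 \<le> f \<delta>"
  obtains x y where "block_local_min (\<lambda>x y. block_fit c s p q x y + f x + g y) x y"
    "9 / 32 * (s\<^sup>2 * R\<^sup>2) \<le> (c * (x - y))\<^sup>2 + (s * (x + y - R))\<^sup>2"
proof -
  define T where "T = {- \<delta>..\<delta>} \<times> (UNIV :: real set)"
  have T: "closed T" "(0, 0) \<in> T" using \<delta> by (auto simp: T_def intro!: closed_Times)
  have c0: "0 < c" using cs by simp
  obtain x y where xy: "(x, y) \<in> T"
    "\<And>x' y'. (x', y') \<in> T \<Longrightarrow> block_fit c s p q x y + f x + g y \<le> block_fit c s p q x' y' + f x' + g y'"
    using block_min_exists[OF cs(1) c0 em l T, of p q] by blast
  have "\<bar>x\<bar> \<noteq> \<delta>"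
  proof
    assume x: "\<bar>x\<bar> = \<delta>"
    have "f \<delta> \<le> f x" by (rule even_mono_le[OF em(1)]) (use x in auto)
    then have "11 * \<delta> * \<bar>x\<bar> \<le> f x" using ft x by (simp add: power2_eq_square)
    moreover have "x \<noteq> 0" using x \<delta> by auto
    ultimately obtain y' where
      "block_fit c s p q 0 y' + f 0 + g y' < block_fit c s p q x y + f x + g y"
      using penalized_coordinate_small[OF cs em \<delta>(1) pq, of x y] by blast
    moreover have "(0, y') \<in> T" using \<delta> by (auto simp: T_def)
    ultimately show False using xy(2) by fastforce
  qed
  then have x: "\<bar>x\<bar> < \<delta>" using xy(1) by (auto simp: T_def)
  have "block_local_min (\<lambda>x y. block_fit c s p q x y + f x + g y) x y"
    unfolding block_local_min_def using x
    by (intro exI[of _ "\<delta> - \<bar>x\<bar>"]) (auto intro!: xy(2) simp: T_def)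
  moreover have "9 / 32 * (s\<^sup>2 * R\<^sup>2) \<le> (c * (x - y))\<^sup>2 + (s * (x + y - R))\<^sup>2"
    using cs x \<delta> by (intro block_error_of_small) auto
  ultimately show ?thesis using that by blast
qed

lemma block_local_min_swap:
  "block_local_min F x y \<Longrightarrow> block_local_min (\<lambda>x y. F y x) y x"
  unfolding block_local_min_def by blast

lemma signal_block_local_min:
  assumes cs: "0 < s" "s \<le> c" "c\<^sup>2 + s\<^sup>2 = 1" and em: "even_mono f" "even_mono g" and l: "lsc f" "lsc g"
    and \<delta>: "0 < \<delta>" "8 * \<delta> \<le> R" and pq: "\<bar>p\<bar> \<le> \<delta>" "s * \<bar>q\<bar> \<le> 2 * \<delta>"
    and ft: "11 * \<delta>\<^sup>2 \<le> max (f \<delta>) (g \<delta>)"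
  obtains x y where "block_local_min (\<lambda>x y. block_fit c s p q x y + f x + g y) x y"
    "9 / 32 * (s\<^sup>2 * R\<^sup>2) \<le> (c * (x - y))\<^sup>2 + (s * (x + y - R))\<^sup>2"
proof (cases "11 * \<delta>\<^sup>2 \<le> f \<delta>")
  case True
  then show ?thesis using signal_block_local_min_aux[OF cs em l \<delta> pq] that by blast
next
  case False
  then have "11 * \<delta>\<^sup>2 \<le> g \<delta>" using ft by auto
  then obtain y x where *: "block_local_min (\<lambda>y x. block_fit c s (- p) q y x + g y + f x) y x"
    "9 / 32 * (s\<^sup>2 * R\<^sup>2) \<le> (c * (y - x))\<^sup>2 + (s * (y + x - R))\<^sup>2"
    using signal_block_local_min_aux[OF cs em(2,1) l(2,1) \<delta>, of "- p" q] pq by auto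
  have "block_local_min (\<lambda>x y. block_fit c s p q x y + f x + g y) x y"
    using block_local_min_swap[OF *(1)] by (simp add: block_fit_swap algebra_simps)
  moreover have "(c * (y - x))\<^sup>2 + (s * (y + x - R))\<^sup>2 = (c * (x - y))\<^sup>2 + (s * (x + y - R))\<^sup>2"
    by (simp add: power2_eq_square algebra_simps)
  ultimately show ?thesis using *(2) by (intro that) simp_all
qed

text \<open>A convex f with f 0 = 0 grows at least linearly beyond \<delta>, so the bound at
  \<delta> becomes \<open>11 * \<delta> * \<bar>x\<bar> \<le> f x\<close> for every larger |x|, and
  no global minimum lies outside the strip.\<close>

lemma signal_block_convex_aux:
  assumes cs: "0 < s" "s \<le> c" "c\<^sup>2 + s\<^sup>2 = 1" and em: "even_mono f" "even_mono g"
    and f: "convex_on UNIV f"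
    and \<delta>: "0 < \<delta>" "8 * \<delta> \<le> R" and pq: "\<bar>p\<bar> \<le> \<delta>" "s * \<bar>q\<bar> \<le> 2 * \<delta>"
    and ft: "11 * \<delta>\<^sup>2 \<le> f \<delta>"
    and min: "\<And>x' y'. block_fit c s p q x y + f x + g y \<le> block_fit c s p q x' y' + f x' + g y'"
  shows "9 / 32 * (s\<^sup>2 * R\<^sup>2) \<le> (c * (x - y))\<^sup>2 + (s * (x + y - R))\<^sup>2"
proof -
  have "\<bar>x\<bar> \<le> \<delta>"
  proof (rule ccontr)
    assume "\<not> \<bar>x\<bar> \<le> \<delta>"
    then have x: "\<delta> < \<bar>x\<bar>" by simp
    have "f \<delta> = f ((1 - \<delta> / \<bar>x\<bar>) *\<^sub>R 0 + (\<delta> / \<bar>x\<bar>) *\<^sub>R \<bar>x\<bar>)" using x \<delta> by simp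
    also have "\<dots> \<le> (1 - \<delta> / \<bar>x\<bar>) * f 0 + (\<delta> / \<bar>x\<bar>) * f \<bar>x\<bar>"
      using x \<delta> by (intro convex_onD[OF f]) auto
    also have "\<dots> = (\<delta> / \<bar>x\<bar>) * f \<bar>x\<bar>" using em by (simp add: even_mono_def)
    finally have "11 * \<delta>\<^sup>2 \<le> (\<delta> / \<bar>x\<bar>) * f \<bar>x\<bar>" using ft by simp
    then have "11 * \<delta> * \<bar>x\<bar> \<le> f \<bar>x\<bar>" using x \<delta> by (simp add: field_simps power2_eq_square)
    also have "\<dots> \<le> f x" using even_mono_le[OF em(1)] by simp
    finally have "11 * \<delta> * \<bar>x\<bar> \<le> f x" .
    moreover have "x \<noteq> 0" using x \<delta> by auto
    ultimately show False
      using penalized_coordinate_small[OF cs em \<delta>(1) pq, of x y] min by (meson not_le)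
  qed
  then show ?thesis using cs \<delta> by (intro block_error_of_small) auto
qed

lemma signal_block_convex:
  assumes cs: "0 < s" "s \<le> c" "c\<^sup>2 + s\<^sup>2 = 1" and em: "even_mono f" "even_mono g"
    and cv: "convex_on UNIV f" "convex_on UNIV g"
    and \<delta>: "0 < \<delta>" "8 * \<delta> \<le> R" and pq: "\<bar>p\<bar> \<le> \<delta>" "s * \<bar>q\<bar> \<le> 2 * \<delta>"
    and ft: "11 * \<delta>\<^sup>2 \<le> max (f \<delta>) (g \<delta>)"
    and min: "\<And>x' y'. block_fit c s p q x y + f x + g y \<le> block_fit c s p q x' y' + f x' + g y'"
  shows "9 / 32 * (s\<^sup>2 * R\<^sup>2) \<le> (c * (x - y))\<^sup>2 + (s * (x + y - R))\<^sup>2"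
proof (cases "11 * \<delta>\<^sup>2 \<le> f \<delta>")
  case True
  then show ?thesis using signal_block_convex_aux[OF cs em cv(1) \<delta> pq _ min] by blast
next
  case False
  then have g: "11 * \<delta>\<^sup>2 \<le> g \<delta>" using ft by auto
  have "block_fit c s (- p) q y x + g y + f x \<le> block_fit c s (- p) q y' x' + g y' + f x'" for x' y'
    using min[of x' y'] by (simp add: block_fit_swap algebra_simps)
  from signal_block_convex_aux[OF cs em(2,1) cv(2) \<delta> _ pq(2) g this] pq(1)
  have "9 / 32 * (s\<^sup>2 * R\<^sup>2) \<le> (c * (y - x))\<^sup>2 + (s * (y + x - R))\<^sup>2" by simp
  also have "\<dots> = (c * (x - y))\<^sup>2 + (s * (x + y - R))\<^sup>2"
    by (simp add: power2_eq_square algebra_simps)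
  finally show ?thesis .
qed

text \<open>The segment from the local minimum to any competitor starts inside the neighbourhood,
  and convexity carries the inequality to its far end.\<close>

lemma block_local_min_convex:
  assumes cv: "convex_on UNIV f" "convex_on UNIV g"
    and lm: "block_local_min (\<lambda>x y. block_fit c s p q x y + f x + g y) x y"
  shows "block_fit c s p q x y + f x + g y \<le> block_fit c s p q x' y' + f x' + g y'"
proof -
  let ?F = "\<lambda>x y. block_fit c s p q x y + f x + g y"
  obtain r where r: "0 < r" "\<And>x' y'. \<bar>x' - x\<bar> < r \<Longrightarrow> \<bar>y' - y\<bar> < r \<Longrightarrow> ?F x y \<le> ?F x' y'"
    using lm unfolding block_local_min_def by blast
  \<comment> \<open>D exceeds both coordinate distances, so a step of size a = r / D stays within r,
    and it exceeds r, so that a < 1.\<close>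
  define D where "D = 1 + \<bar>x' - x\<bar> + \<bar>y' - y\<bar> + r"
  define a where "a = r / D"
  have D: "0 < D" "r < D" using r by (auto simp: D_def)
  have a: "0 < a" "a < 1" using r D by (auto simp: a_def)
  have sm: "a * z < r" if "z < D" for z using that r D by (simp add: a_def field_simps)
  let ?x = "(1 - a) * x + a * x'" let ?y = "(1 - a) * y + a * y'"
  have "?x - x = a * (x' - x)" "?y - y = a * (y' - y)" by (simp_all add: algebra_simps)
  moreover have "\<bar>x' - x\<bar> < D" "\<bar>y' - y\<bar> < D" using r by (auto simp: D_def)
  ultimately have "\<bar>?x - x\<bar> < r" "\<bar>?y - y\<bar> < r" using a sm by (auto simp: abs_mult)
  then have "?F x y \<le> ?F ?x ?y" by (rule r(2))
  also have "\<dots> \<le> (1 - a) * ?F x y + a * ?F x' y'"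
  proof -
    have sq: "((1 - a) * u + a * v)\<^sup>2 \<le> (1 - a) * u\<^sup>2 + a * v\<^sup>2" for u v :: real
    proof -
      have "(1 - a) * u\<^sup>2 + a * v\<^sup>2 - ((1 - a) * u + a * v)\<^sup>2 = a * (1 - a) * (u - v)\<^sup>2"
        by (simp add: power2_eq_square algebra_simps)
      also have "\<dots> \<ge> 0" using a by simp
      finally show ?thesis by simp
    qed
    have "block_fit c s p q ?x ?y = ((1 - a) * (c * (x - y) - p) + a * (c * (x' - y') - p))\<^sup>2
       + ((1 - a) * (s * (x + y) - q) + a * (s * (x' + y') - q))\<^sup>2"
      unfolding block_fit_def by (simp add: algebra_simps)
    also have "\<dots> \<le> (1 - a) * block_fit c s p q x y + a * block_fit c s p q x' y'"
      using sq[of "c * (x - y) - p" "c * (x' - y') - p"] sq[of "s * (x + y) - q" "s * (x' + y') - q"]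
      unfolding block_fit_def by (simp only: distrib_left)
    finally have 1: "block_fit c s p q ?x ?y \<le> (1 - a) * block_fit c s p q x y + a * block_fit c s p q x' y'" .
    have 2: "f ?x \<le> (1 - a) * f x + a * f x'" using convex_onD[OF cv(1), of a x x'] a by simp
    have 3: "g ?y \<le> (1 - a) * g y + a * g y'" using convex_onD[OF cv(2), of a y y'] a by simp
    from 1 2 3 show ?thesis by (simp add: algebra_simps)
  qed
  finally have "a * ?F x y \<le> a * ?F x' y'" by (simp add: algebra_simps)
  then show ?thesis using a by simp
qed

text \<open>With a cheap penalty at \<delta> and p well above \<delta>, fitting the noise pays: a
  global minimizer near 0 would lose to an explicit point of scale \<delta>.\<close>

lemma null_block_error:
  assumes cs: "0 < s" "c\<^sup>2 + s\<^sup>2 = 1" "7 / 8 \<le> c"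
    and em: "even_mono f" "even_mono g"
    and \<delta>: "0 < \<delta>" and pq: "10 * \<delta> \<le> p" "p \<le> 11 * \<delta>" "\<bar>q\<bar> \<le> \<delta>"
    and ft: "max (f \<delta>) (g \<delta>) < 11 * \<delta>\<^sup>2"
    and min: "\<And>x' y'. block_fit c s p q x y + f x + g y \<le> block_fit c s p q x' y' + f x' + g y'"
  shows "\<delta>\<^sup>2 / 16 \<le> (c * (x - y))\<^sup>2 + (s * (x + y))\<^sup>2"
proof (rule ccontr)
  assume "\<not> ?thesis"
  then have E: "(c * (x - y))\<^sup>2 + (s * (x + y))\<^sup>2 < \<delta>\<^sup>2 / 16" by simp
  have d16: "\<delta>\<^sup>2 / 16 = (\<delta> / 4)\<^sup>2" by (simp add: power2_eq_square)
  have "(c * (x - y))\<^sup>2 \<le> (\<delta> / 4)\<^sup>2" using E d16 zero_le_power2[of "s * (x + y)"] by linarith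
  then have "\<bar>c * (x - y)\<bar> \<le> \<bar>\<delta> / 4\<bar>" by (simp only: abs_le_square_iff)
  then have u: "\<bar>c * (x - y)\<bar> \<le> \<delta> / 4" using \<delta> by simp
  have "(s * (x + y))\<^sup>2 \<le> (\<delta> / 4)\<^sup>2" using E d16 zero_le_power2[of "c * (x - y)"] by linarith
  then have "\<bar>s * (x + y)\<bar> \<le> \<bar>\<delta> / 4\<bar>" by (simp only: abs_le_square_iff)
  then have v: "\<bar>s * (x + y)\<bar> \<le> \<delta> / 4" using \<delta> by simp
  have c1: "c\<^sup>2 \<le> 1" using cs by (metis le_add_same_cancel1 zero_le_power2)
  have "f x \<ge> 0" "g y \<ge> 0" using em by (auto intro: even_mono_nonneg)
  moreover have "g (- \<delta>) = g \<delta>" using em by (auto simp: even_mono_def)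
  \<comment> \<open>The competitor (\<delta>, -\<delta>) has coordinate sum 0, so it fits p without
    touching q. After cancelling p^2 + q^2 its value is at most (4 - 35 + 22) \<delta>^2 = -9
    \<delta>^2, whereas small error keeps the left side at or above -6 \<delta>^2.\<close>
  ultimately have "block_fit c s p q x y \<le> block_fit c s p q \<delta> (- \<delta>) + 22 * \<delta>\<^sup>2"
    using min[of \<delta> "- \<delta>"] ft by simp
  then have "(c * (x - y))\<^sup>2 + (s * (x + y))\<^sup>2 - 2 * (p * (c * (x - y))) - 2 * (q * (s * (x + y)))
      \<le> 4 * (c\<^sup>2 * \<delta>\<^sup>2) - 4 * (c * (\<delta> * p)) + 22 * \<delta>\<^sup>2"
    unfolding block_fit_def by (simp add: power2_eq_square algebra_simps)
  moreover have "c\<^sup>2 * \<delta>\<^sup>2 \<le> 1 * \<delta>\<^sup>2" using c1 by (intro mult_right_mono) auto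
  moreover have "35 / 4 * \<delta>\<^sup>2 \<le> c * (\<delta> * p)"
  proof -
    have "7 / 8 * (\<delta> * (10 * \<delta>)) \<le> c * (\<delta> * p)"
      using cs pq \<delta> by (intro mult_mono) auto
    then show ?thesis by (simp add: power2_eq_square)
  qed
  moreover have "p * (c * (x - y)) \<le> 11 / 4 * \<delta>\<^sup>2"
  proof -
    have "p * (c * (x - y)) \<le> p * (\<delta> / 4)" using u pq \<delta> by (intro mult_left_mono) auto
    also have "\<dots> \<le> (11 * \<delta>) * (\<delta> / 4)" using pq \<delta> by (intro mult_right_mono) auto
    finally show ?thesis by (simp add: power2_eq_square)
  qed
  moreover have "q * (s * (x + y)) \<le> 1 / 4 * \<delta>\<^sup>2"
  proof -
    have "q * (s * (x + y)) \<le> \<bar>q\<bar> * \<bar>s * (x + y)\<bar>" by (metis abs_ge_self abs_mult)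
    also have "\<dots> \<le> \<delta> * (\<delta> / 4)" using v pq \<delta> by (intro mult_mono) auto
    finally show ?thesis by (simp add: power2_eq_square)
  qed
  moreover have "0 \<le> (c * (x - y))\<^sup>2" "0 \<le> (s * (x + y))\<^sup>2" by auto
  moreover have "0 < \<delta>\<^sup>2" using \<delta> by simp
  ultimately show False by linarith
qed

section \<open>Vectors, penalties and the block design\<close>

unbundle no vec_syntax

text \<open>Indices 2 b and 2 b + 1 form block b. The tail is the last row for odd n when summing
  over rows, and all columns outside the blocks when summing over \<open>{..<d}\<close>.\<close>

lemma sum_lessThan_pairs:
  fixes f :: "nat \<Rightarrow> real"
  assumes "2 * m \<le> n"
  shows "(\<Sum>i<n. f i) = (\<Sum>b<m. f (2 * b) + f (2 * b + 1)) + (\<Sum>i\<in>{2 * m..<n}. f i)"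
proof -
  have "(\<Sum>i<2 * m. f i) = (\<Sum>b<m. f (2 * b) + f (2 * b + 1))"
    by (induction m) (simp_all add: add.assoc)
  moreover have "(\<Sum>i<n. f i) = (\<Sum>i<2 * m. f i) + (\<Sum>i\<in>{2 * m..<n}. f i)"
    using assms by (metis atLeast0LessThan le0 sum.atLeastLessThan_concat)
  ultimately show ?thesis by simp
qed

lemma l2_norm_sq: "(l2_norm v)\<^sup>2 = (\<Sum>i<dim_vec v. (v $ i)\<^sup>2)"
  unfolding l2_norm_def L2_set_def by (simp add: sum_nonneg)

lemma abs_index_le_l2_norm: "i < dim_vec v \<Longrightarrow> \<bar>v $ i\<bar> \<le> l2_norm v"
  using member_le_L2_set[of "{..<dim_vec v}" i "\<lambda>i. \<bar>v $ i\<bar>"] by (simp add: l2_norm_def L2_set_def)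

lemma l2_norm_le_sum_abs: "l2_norm v \<le> (\<Sum>i<dim_vec v. \<bar>v $ i\<bar>)"
  unfolding l2_norm_def by (rule L2_set_le_sum_abs)

section \<open>Separable penalties along a coordinate axis\<close>

definition axis_vec :: "nat \<Rightarrow> nat \<Rightarrow> real \<Rightarrow> real Matrix.vec" where
  "axis_vec d j x = Matrix.vec d (\<lambda>i. if i = j then x else 0)"

lemma axis_vec_carrier [simp]: "axis_vec d j x \<in> carrier_vec d"
  by (simp add: axis_vec_def)

lemma l2_norm_axis_vec_diff:
  assumes "j < d" shows "l2_norm (axis_vec d j x - axis_vec d j y) \<le> \<bar>x - y\<bar>"
proof -
  have "(\<Sum>i<d. \<bar>(axis_vec d j x - axis_vec d j y) $ i\<bar>) = (\<Sum>i<d. if i = j then \<bar>x - y\<bar> else 0)"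
    by (intro sum.cong) (auto simp: axis_vec_def)
  then show ?thesis
    using l2_norm_le_sum_abs[of "axis_vec d j x - axis_vec d j y"] assms by (simp add: axis_vec_def)
qed

text \<open>Membership in \<open>separable_penalties\<close> only asserts that coordinate functions
  exist; this predicate names them, so that statements can refer to a fixed choice.\<close>

definition separates :: "nat \<Rightarrow> (real Matrix.vec \<Rightarrow> real) \<Rightarrow> (nat \<Rightarrow> real \<Rightarrow> real) \<Rightarrow> bool" where
  "separates d \<rho> \<rho>j \<longleftrightarrow> (\<forall>\<theta>\<in>carrier_vec d. \<rho> \<theta> = (\<Sum>j<d. \<rho>j j (\<theta> $ j))) \<and> (\<forall>j<d. even_mono (\<rho>j j))"

lemma separable_penalties_separates:
  "\<rho> \<in> separable_penalties d \<Longrightarrow> \<exists>\<rho>j. separates d \<rho> \<rho>j"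
  unfolding separable_penalties_def separates_def even_mono_def by blast

text \<open>All other coordinate functions vanish at 0. Through this restriction, semicontinuity and
  convexity, which are assumed of \<rho> as a function of vectors, reach the univariate
  functions.\<close>

lemma separates_axis_vec:
  assumes "separates d \<rho> \<rho>j" "j < d"
  shows "\<rho> (axis_vec d j x) = \<rho>j j x"
proof -
  have "\<rho> (axis_vec d j x) = (\<Sum>i<d. \<rho>j i (axis_vec d j x $ i))"
    using assms by (simp add: separates_def)
  also have "\<dots> = (\<Sum>i<d. if i = j then \<rho>j j x else 0)"
  proof (intro sum.cong refl)
    fix i assume i: "i \<in> {..<d}"
    then have "\<rho>j i 0 = 0" using assms unfolding separates_def even_mono_def by blast
    then show "\<rho>j i (axis_vec d j x $ i) = (if i = j then \<rho>j j x else 0)"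
      using i by (simp add: axis_vec_def)
  qed
  finally show ?thesis using assms by simp
qed

lemma lsc_penalty_coordinate:
  assumes "separates d \<rho> \<rho>j" "lsc_penalty d \<rho>" "j < d"
  shows "lsc (\<rho>j j)"
  unfolding lsc_def
proof (intro allI)
  fix a
  show "open {x. a < \<rho>j j x}"
    unfolding open_dist
  proof safe
    fix x assume x: "a < \<rho>j j x"
    then have "\<rho>j j x - a > 0" by simp
    then obtain r where r: "r > 0"
      "\<And>v. v \<in> open_ball d (axis_vec d j x) r \<Longrightarrow> \<rho> (axis_vec d j x) - (\<rho>j j x - a) < \<rho> v"
      using assms(2) unfolding lsc_penalty_def by (meson axis_vec_carrier)
    have "a < \<rho>j j y" if "dist y x < r" for y
    proof -
      have "axis_vec d j y \<in> open_ball d (axis_vec d j x) r"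
        using that l2_norm_axis_vec_diff[OF assms(3), of y x] by (auto simp: open_ball_def dist_real_def)
      from r(2)[OF this] show ?thesis using separates_axis_vec[OF assms(1,3)] by simp
    qed
    then show "\<exists>e>0. \<forall>y. dist y x < e \<longrightarrow> y \<in> {x. a < \<rho>j j x}" using r(1) by blast
  qed
qed

lemma convex_penalty_coordinate:
  assumes "separates d \<rho> \<rho>j" "convex_penalty d \<rho>" "j < d"
  shows "convex_on UNIV (\<rho>j j)"
proof (rule convex_onI)
  fix t x y :: real assume t: "0 < t" "t < 1"
  have "\<rho> (t \<cdot>\<^sub>v axis_vec d j y + (1 - t) \<cdot>\<^sub>v axis_vec d j x)
      \<le> t * \<rho> (axis_vec d j y) + (1 - t) * \<rho> (axis_vec d j x)"
    using assms(2) t unfolding convex_penalty_def by auto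
  moreover have "t \<cdot>\<^sub>v axis_vec d j y + (1 - t) \<cdot>\<^sub>v axis_vec d j x = axis_vec d j (t * y + (1 - t) * x)"
    by (intro eq_vecI) (auto simp: axis_vec_def)
  ultimately show "\<rho>j j ((1 - t) *\<^sub>R x + t *\<^sub>R y) \<le> (1 - t) * \<rho>j j x + t * \<rho>j j y"
    using separates_axis_vec[OF assms(1,3)] by (simp add: add.commute)
qed simp

section \<open>The block design\<close>

definition block_design :: "nat \<Rightarrow> nat \<Rightarrow> real \<Rightarrow> real \<Rightarrow> real mat" where
  "block_design n d c s = Matrix.mat n d (\<lambda>(i, j).
     if j < 2 * (n div 2) \<and> i div 2 = j div 2
     then sqrt (real n) * (if even i then (if even j then c else - c) else s) else 0)"

lemma block_design_carrier [simp]: "block_design n d c s \<in> carrier_mat n d"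
  by (simp add: block_design_def)

lemma block_design_dims [simp]: "dim_row (block_design n d c s) = n" "dim_col (block_design n d c s) = d"
  by (simp_all add: block_design_def)

lemma div_2_eq_iff: "(i::nat) div 2 = b \<longleftrightarrow> i = 2 * b \<or> i = 2 * b + 1"
  by presburger

lemma block_design_mult:
  assumes "n \<le> d" "\<theta> \<in> carrier_vec d"
  shows "b < n div 2 \<Longrightarrow> (block_design n d c s *\<^sub>v \<theta>) $ (2 * b) = sqrt (real n) * (c * (\<theta> $ (2 * b) - \<theta> $ (2 * b + 1)))"
    and "b < n div 2 \<Longrightarrow> (block_design n d c s *\<^sub>v \<theta>) $ (2 * b + 1) = sqrt (real n) * (s * (\<theta> $ (2 * b) + \<theta> $ (2 * b + 1)))"
    and "2 * (n div 2) \<le> i \<Longrightarrow> i < n \<Longrightarrow> (block_design n d c s *\<^sub>v \<theta>) $ i = 0"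
proof -
  have *: "(block_design n d c s *\<^sub>v \<theta>) $ i = (\<Sum>j<d. block_design n d c s $$ (i, j) * \<theta> $ j)" if "i < n" for i
    using that assms by (simp add: scalar_prod_def lessThan_atLeast0 row_def)
  have pair: "(block_design n d c s *\<^sub>v \<theta>) $ i = block_design n d c s $$ (i, 2 * b) * \<theta> $ (2 * b)
      + block_design n d c s $$ (i, 2 * b + 1) * \<theta> $ (2 * b + 1)" if "i div 2 = b" "b < n div 2" for i b
  proof -
    have "i < n" using that by linarith
    then have "(block_design n d c s *\<^sub>v \<theta>) $ i = (\<Sum>j<d. block_design n d c s $$ (i, j) * \<theta> $ j)"
      by (rule *)
    also have "\<dots> = (\<Sum>j\<in>{2 * b, 2 * b + 1}. block_design n d c s $$ (i, j) * \<theta> $ j)"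
    proof (intro sum.mono_neutral_right ballI)
      show "{2 * b, 2 * b + 1} \<subseteq> {..<d}" using that assms by auto
      fix j assume "j \<in> {..<d} - {2 * b, 2 * b + 1}"
      then have "j < d" "j div 2 \<noteq> b" by (auto simp: div_2_eq_iff)
      then show "block_design n d c s $$ (i, j) * \<theta> $ j = 0"
        using that \<open>i < n\<close> by (simp add: block_design_def)
    qed auto
    finally show ?thesis by simp
  qed
  have lt: "2 * b + 1 < 2 * (n div 2)" "2 * b + 1 < n" "2 * b + 1 < d" if "b < n div 2"
    using that assms by linarith+
  show "(block_design n d c s *\<^sub>v \<theta>) $ (2 * b) = sqrt (real n) * (c * (\<theta> $ (2 * b) - \<theta> $ (2 * b + 1)))"
    if "b < n div 2"
    using pair[of "2 * b" b] that lt[OF that] by (simp add: block_design_def algebra_simps)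
  show "(block_design n d c s *\<^sub>v \<theta>) $ (2 * b + 1) = sqrt (real n) * (s * (\<theta> $ (2 * b) + \<theta> $ (2 * b + 1)))"
    if "b < n div 2"
    using pair[of "2 * b + 1" b] that lt[OF that] by (simp add: block_design_def algebra_simps)
  show "(block_design n d c s *\<^sub>v \<theta>) $ i = 0" if "2 * (n div 2) \<le> i" "i < n"
  proof -
    have "j < 2 * (n div 2) \<Longrightarrow> i div 2 \<noteq> j div 2" for j using that by presburger
    then have "\<forall>j<d. block_design n d c s $$ (i, j) = 0"
      using that(2) by (auto simp: block_design_def)
    then show ?thesis unfolding *[OF that(2)] by simp
  qed
qed

text \<open>A column inside a block has exactly two nonzero entries, whose squares add up to n (c^2
  + s^2) = n; the remaining columns are zero.\<close>

lemma block_design_col_norm: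
  assumes "0 < n" "n \<le> d" "c\<^sup>2 + s\<^sup>2 = 1" "j < d"
  shows "l2_norm (col (block_design n d c s) j) / sqrt (real n) \<le> 1"
proof -
  let ?X = "block_design n d c s"
  have sq: "(l2_norm (col ?X j))\<^sup>2 = (\<Sum>i<n. (?X $$ (i, j))\<^sup>2)"
    using assms by (simp add: l2_norm_sq)
  have "(\<Sum>i<n. (?X $$ (i, j))\<^sup>2) \<le> real n"
  proof (cases "j < 2 * (n div 2)")
    case True
    define b where "b = j div 2"
    have b1: "b < n div 2" using True unfolding b_def by linarith
    then have "2 * b + 1 < n" by linarith
    note b = b1 this
    have "(\<Sum>i<n. (?X $$ (i, j))\<^sup>2) = (\<Sum>i\<in>{2 * b, 2 * b + 1}. (?X $$ (i, j))\<^sup>2)"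
    proof (intro sum.mono_neutral_right ballI)
      show "{2 * b, 2 * b + 1} \<subseteq> {..<n}" using b by auto
      fix i assume "i \<in> {..<n} - {2 * b, 2 * b + 1}"
      then have "i < n" "i div 2 \<noteq> j div 2" by (auto simp: div_2_eq_iff b_def)
      then show "(?X $$ (i, j))\<^sup>2 = 0" using assms by (simp add: block_design_def)
    qed auto
    also have "\<dots> = real n * (c\<^sup>2 + s\<^sup>2)"
      unfolding distrib_left
      using b True assms(2,4) by (simp add: block_design_def b_def power_mult_distrib)
    finally show ?thesis using assms by simp
  next
    case False
    then show ?thesis using assms by (simp add: block_design_def)
  qed
  then have "(l2_norm (col ?X j))\<^sup>2 \<le> (sqrt (real n))\<^sup>2" using sq by simp
  then have "l2_norm (col ?X j) \<le> sqrt (real n)" by (rule power2_le_imp_le) simp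
  then show ?thesis using assms by simp
qed

section \<open>Prediction error and objective as sums over blocks\<close>

lemma prediction_error_block_design:
  assumes "n \<le> d" "0 < n" "\<theta>s \<in> carrier_vec d" "\<theta> \<in> carrier_vec d"
  shows "prediction_error (block_design n d c s) \<theta>s \<theta> = (\<Sum>b<n div 2.
    (c * ((\<theta> $ (2 * b) - \<theta>s $ (2 * b)) - (\<theta> $ (2 * b + 1) - \<theta>s $ (2 * b + 1))))\<^sup>2
    + (s * ((\<theta> $ (2 * b) - \<theta>s $ (2 * b)) + (\<theta> $ (2 * b + 1) - \<theta>s $ (2 * b + 1))))\<^sup>2)"
proof -
  let ?v = "block_design n d c s *\<^sub>v (\<theta> - \<theta>s)"
  have v: "\<theta> - \<theta>s \<in> carrier_vec d" using assms by simp
  have "(l2_norm ?v)\<^sup>2 = (\<Sum>b<n div 2. (?v $ (2 * b))\<^sup>2 + (?v $ (2 * b + 1))\<^sup>2)"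
    by (subst l2_norm_sq, subst sum_lessThan_pairs[of "n div 2"])
      (auto simp: block_design_mult(3)[OF assms(1) v] simp del: index_mult_mat_vec)
  then have "prediction_error (block_design n d c s) \<theta>s \<theta> = (\<Sum>b<n div 2. ((?v $ (2 * b))\<^sup>2 + (?v $ (2 * b + 1))\<^sup>2) / real n)"
    by (simp only: prediction_error_def sum_divide_distrib block_design_dims)
  also have "\<dots> = (\<Sum>b<n div 2.
    (c * ((\<theta> $ (2 * b) - \<theta>s $ (2 * b)) - (\<theta> $ (2 * b + 1) - \<theta>s $ (2 * b + 1))))\<^sup>2
    + (s * ((\<theta> $ (2 * b) - \<theta>s $ (2 * b)) + (\<theta> $ (2 * b + 1) - \<theta>s $ (2 * b + 1))))\<^sup>2)"
  proof (intro sum.cong refl)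
    fix b assume "b \<in> {..<n div 2}"
    then have b: "b < n div 2" by simp
    then have lt: "2 * b + 1 < d" using assms(1) by linarith
    have i: "(\<theta> - \<theta>s) $ (2 * b) = \<theta> $ (2 * b) - \<theta>s $ (2 * b)"
      "(\<theta> - \<theta>s) $ (2 * b + 1) = \<theta> $ (2 * b + 1) - \<theta>s $ (2 * b + 1)"
      using lt assms(3,4) by simp_all
    show "((?v $ (2 * b))\<^sup>2 + (?v $ (2 * b + 1))\<^sup>2) / real n =
      (c * ((\<theta> $ (2 * b) - \<theta>s $ (2 * b)) - (\<theta> $ (2 * b + 1) - \<theta>s $ (2 * b + 1))))\<^sup>2
    + (s * ((\<theta> $ (2 * b) - \<theta>s $ (2 * b)) + (\<theta> $ (2 * b + 1) - \<theta>s $ (2 * b + 1))))\<^sup>2"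
      unfolding block_design_mult(1,2)[OF assms(1) v b] i using assms(2)
      by (simp add: power_mult_distrib flip: distrib_left)
  qed
  finally show ?thesis .
qed

text \<open>Together with \<open>block_q\<close>, the two responses of block b divided by sqrt n.
  This scaling absorbs the factor 1/n of the squared loss and turns noise of scale \<sigma> into
  noise of scale \<sigma> / sqrt n.\<close>

definition block_p :: "nat \<Rightarrow> real \<Rightarrow> real Matrix.vec \<Rightarrow> (nat \<Rightarrow> real) \<Rightarrow> nat \<Rightarrow> real" where
  "block_p n c \<theta>s w b = c * (\<theta>s $ (2 * b) - \<theta>s $ (2 * b + 1)) + w (2 * b) / sqrt (real n)"

definition block_q :: "nat \<Rightarrow> real \<Rightarrow> real Matrix.vec \<Rightarrow> (nat \<Rightarrow> real) \<Rightarrow> nat \<Rightarrow> real" where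
  "block_q n s \<theta>s w b = s * (\<theta>s $ (2 * b) + \<theta>s $ (2 * b + 1)) + w (2 * b + 1) / sqrt (real n)"

definition block_objective ::
  "nat \<Rightarrow> real \<Rightarrow> real \<Rightarrow> real Matrix.vec \<Rightarrow> (nat \<Rightarrow> real) \<Rightarrow> (nat \<Rightarrow> real \<Rightarrow> real) \<Rightarrow> real \<Rightarrow> nat \<Rightarrow> real \<Rightarrow> real \<Rightarrow> real" where
  "block_objective n c s \<theta>s w \<rho>j lam b x y =
     block_fit c s (block_p n c \<theta>s w b) (block_q n s \<theta>s w b) x y
       + lam * \<rho>j (2 * b) x + lam * \<rho>j (2 * b + 1) y"

text \<open>The two trailing sums do not couple the blocks: for odd n the last row of the design is
  zero and contributes only a constant, and the columns outside the blocks are zero and enter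
  through their penalty alone.\<close>

lemma objective_block_design:
  assumes "n \<le> d" "0 < n" "\<theta>s \<in> carrier_vec d" "\<theta> \<in> carrier_vec d" "separates d \<rho> \<rho>j"
  shows "objective (block_design n d c s) (response (block_design n d c s) \<theta>s w) \<rho> lam \<theta> =
    (\<Sum>b<n div 2. block_objective n c s \<theta>s w \<rho>j lam b (\<theta> $ (2 * b)) (\<theta> $ (2 * b + 1)))
    + (\<Sum>i\<in>{2 * (n div 2)..<n}. (w i)\<^sup>2) / real n + (\<Sum>j\<in>{2 * (n div 2)..<d}. lam * \<rho>j j (\<theta> $ j))"
proof -
  let ?X = "block_design n d c s"
  let ?v = "response ?X \<theta>s w - ?X *\<^sub>v \<theta>"
  have v: "?v $ i = (?X *\<^sub>v \<theta>s) $ i + w i - (?X *\<^sub>v \<theta>) $ i" if "i < n" for i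
    using that by (simp add: response_def)
  have "(l2_norm ?v)\<^sup>2 = (\<Sum>b<n div 2. (?v $ (2 * b))\<^sup>2 + (?v $ (2 * b + 1))\<^sup>2)
      + (\<Sum>i\<in>{2 * (n div 2)..<n}. (?v $ i)\<^sup>2)"
    by (subst l2_norm_sq, subst sum_lessThan_pairs[of "n div 2"]) (auto simp: response_def)
  also have "(\<Sum>i\<in>{2 * (n div 2)..<n}. (?v $ i)\<^sup>2) = (\<Sum>i\<in>{2 * (n div 2)..<n}. (w i)\<^sup>2)"
  proof (intro sum.cong refl)
    fix i assume "i \<in> {2 * (n div 2)..<n}"
    then have i: "2 * (n div 2) \<le> i" "i < n" by simp_all
    show "(?v $ i)\<^sup>2 = (w i)\<^sup>2"
      unfolding v[OF i(2)] block_design_mult(3)[OF assms(1,3) i] block_design_mult(3)[OF assms(1,4) i] by simp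
  qed
  finally have 1: "(l2_norm ?v)\<^sup>2 / real n = (\<Sum>b<n div 2. ((?v $ (2 * b))\<^sup>2 + (?v $ (2 * b + 1))\<^sup>2) / real n)
      + (\<Sum>i\<in>{2 * (n div 2)..<n}. (w i)\<^sup>2) / real n"
    by (simp only: add_divide_distrib sum_divide_distrib)
  have sq: "(sqrt (real n) * a + x - sqrt (real n) * b)\<^sup>2 / real n = (b - (a + x / sqrt (real n)))\<^sup>2" for a b x
  proof -
    have "sqrt (real n) * a + x - sqrt (real n) * b = - (sqrt (real n) * (b - (a + x / sqrt (real n))))"
      using assms(2) by (simp add: algebra_simps)
    then show ?thesis using assms(2) by (simp only: power2_minus power_mult_distrib) simp
  qed
  have 2: "((?v $ (2 * b))\<^sup>2 + (?v $ (2 * b + 1))\<^sup>2) / real n =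
      block_fit c s (block_p n c \<theta>s w b) (block_q n s \<theta>s w b) (\<theta> $ (2 * b)) (\<theta> $ (2 * b + 1))"
    if b: "b < n div 2" for b
  proof -
    have lt: "2 * b < n" "2 * b + 1 < n" using b by linarith+
    show ?thesis
      unfolding v[OF lt(1)] v[OF lt(2)] block_design_mult(1,2)[OF assms(1,3) b] block_design_mult(1,2)[OF assms(1,4) b]
        add_divide_distrib sq block_fit_def block_p_def block_q_def ..
  qed
  have 3: "lam * \<rho> \<theta> = (\<Sum>b<n div 2. lam * \<rho>j (2 * b) (\<theta> $ (2 * b)) + lam * \<rho>j (2 * b + 1) (\<theta> $ (2 * b + 1)))
      + (\<Sum>j\<in>{2 * (n div 2)..<d}. lam * \<rho>j j (\<theta> $ j))"
  proof -
    have "lam * \<rho> \<theta> = (\<Sum>j<d. lam * \<rho>j j (\<theta> $ j))"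
      using assms by (simp add: separates_def sum_distrib_left)
    then show ?thesis using assms(1) by (subst (asm) sum_lessThan_pairs[of "n div 2"]) auto
  qed
  have "objective ?X (response ?X \<theta>s w) \<rho> lam \<theta> = (l2_norm ?v)\<^sup>2 / real n + lam * \<rho> \<theta>"
    by (simp add: objective_def)
  also have "\<dots> = (\<Sum>b<n div 2. block_fit c s (block_p n c \<theta>s w b) (block_q n s \<theta>s w b) (\<theta> $ (2 * b)) (\<theta> $ (2 * b + 1)))
      + (\<Sum>i\<in>{2 * (n div 2)..<n}. (w i)\<^sup>2) / real n + lam * \<rho> \<theta>"
    unfolding 1 by (intro arg_cong2[where f = "(+)"] sum.cong refl 2) simp
  finally show ?thesis unfolding 3 block_objective_def by (simp add: sum.distrib)
qed

lemma local_minima_block: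
  assumes "n \<le> d" "0 < n" "\<theta>s \<in> carrier_vec d" "separates d \<rho> \<rho>j"
    and lm: "\<theta> \<in> local_minima (block_design n d c s) (response (block_design n d c s) \<theta>s w) \<rho> lam"
    and b: "b < n div 2"
  shows "block_local_min (block_objective n c s \<theta>s w \<rho>j lam b) (\<theta> $ (2 * b)) (\<theta> $ (2 * b + 1))"
proof -
  let ?O = "objective (block_design n d c s) (response (block_design n d c s) \<theta>s w) \<rho> lam"
  let ?F = "block_objective n c s \<theta>s w \<rho>j lam"
  have \<theta>: "\<theta> \<in> carrier_vec d" using lm by (simp add: local_minima_def)
  obtain r where r: "r > 0" "\<And>\<theta>'. \<theta>' \<in> open_ball d \<theta> r \<Longrightarrow> ?O \<theta> \<le> ?O \<theta>'"
    using lm unfolding local_minima_def by auto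
  have b1: "2 * b + 1 < d" using b assms(1) by linarith
  show ?thesis unfolding block_local_min_def
  \<comment> \<open>Half the radius, because the Euclidean distance is estimated by the sum of two
    coordinate deviations.\<close>
  proof (intro exI[of _ "r / 2"] conjI allI impI)
    show "r / 2 > 0" using r by simp
    fix x y assume xy: "\<bar>x - \<theta> $ (2 * b)\<bar> < r / 2" "\<bar>y - \<theta> $ (2 * b + 1)\<bar> < r / 2"
    define \<theta>' where "\<theta>' = Matrix.vec d (\<lambda>i. if i = 2 * b then x else if i = 2 * b + 1 then y else \<theta> $ i)"
    have \<theta>': "\<theta>' \<in> carrier_vec d" by (simp add: \<theta>'_def)
    have same: "\<theta>' $ i = \<theta> $ i" if "i < d" "i \<noteq> 2 * b" "i \<noteq> 2 * b + 1" for i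
      using that by (simp add: \<theta>'_def)
    have at: "\<theta>' $ (2 * b) = x" "\<theta>' $ (2 * b + 1) = y" using b1 by (simp_all add: \<theta>'_def)
    have "l2_norm (\<theta>' - \<theta>) \<le> (\<Sum>i<d. \<bar>\<theta>' $ i - \<theta> $ i\<bar>)"
      using l2_norm_le_sum_abs[of "\<theta>' - \<theta>"] \<theta> \<theta>' by simp
    also have "\<dots> = (\<Sum>i\<in>{2 * b, 2 * b + 1}. \<bar>\<theta>' $ i - \<theta> $ i\<bar>)"
      using b1 by (intro sum.mono_neutral_right) (auto simp: same)
    also have "\<dots> < r" using xy at by simp
    finally have "?O \<theta> \<le> ?O \<theta>'" using r(2) \<theta>' by (simp add: open_ball_def)
    moreover have "(\<Sum>j\<in>{2 * (n div 2)..<d}. lam * \<rho>j j (\<theta>' $ j)) = (\<Sum>j\<in>{2 * (n div 2)..<d}. lam * \<rho>j j (\<theta> $ j))"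
    proof (intro sum.cong refl)
      fix j assume "j \<in> {2 * (n div 2)..<d}"
      then have "j < d" "j \<noteq> 2 * b" "j \<noteq> 2 * b + 1" using b by auto
      then show "lam * \<rho>j j (\<theta>' $ j) = lam * \<rho>j j (\<theta> $ j)" by (simp add: same)
    qed
    moreover have "(\<Sum>b'<n div 2. ?F b' (\<theta>' $ (2 * b')) (\<theta>' $ (2 * b' + 1)))
        = ?F b x y + (\<Sum>b'\<in>{..<n div 2} - {b}. ?F b' (\<theta> $ (2 * b')) (\<theta> $ (2 * b' + 1)))"
    proof (subst sum.remove[of _ b])
      have "?F b' (\<theta>' $ (2 * b')) (\<theta>' $ (2 * b' + 1)) = ?F b' (\<theta> $ (2 * b')) (\<theta> $ (2 * b' + 1))"
        if b': "b' \<in> {..<n div 2} - {b}" for b'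
      proof -
        have "b' < n div 2" "b' \<noteq> b" using b' by auto
        then have "2 * b' < d" "2 * b' + 1 < d" "2 * b' \<noteq> 2 * b" "2 * b' \<noteq> 2 * b + 1" "2 * b' + 1 \<noteq> 2 * b" "2 * b' + 1 \<noteq> 2 * b + 1"
          using assms(1) by presburger+
        then show ?thesis using same[of "2 * b'"] same[of "2 * b' + 1"] by simp
      qed
      then show "?F b (\<theta>' $ (2 * b)) (\<theta>' $ (2 * b + 1)) + (\<Sum>b'\<in>{..<n div 2} - {b}. ?F b' (\<theta>' $ (2 * b')) (\<theta>' $ (2 * b' + 1)))
        = ?F b x y + (\<Sum>b'\<in>{..<n div 2} - {b}. ?F b' (\<theta> $ (2 * b')) (\<theta> $ (2 * b' + 1)))"
        unfolding at by (intro arg_cong2[where f = "(+)"] sum.cong refl)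
    qed (use b in auto)
    moreover have "(\<Sum>b'<n div 2. ?F b' (\<theta> $ (2 * b')) (\<theta> $ (2 * b' + 1)))
        = ?F b (\<theta> $ (2 * b)) (\<theta> $ (2 * b + 1)) + (\<Sum>b'\<in>{..<n div 2} - {b}. ?F b' (\<theta> $ (2 * b')) (\<theta> $ (2 * b' + 1)))"
      using b by (intro sum.remove) auto
    ultimately show "?F b (\<theta> $ (2 * b)) (\<theta> $ (2 * b + 1)) \<le> ?F b x y"
      unfolding objective_block_design[OF assms(1-3) \<theta> assms(4)] objective_block_design[OF assms(1-3) \<theta>' assms(4)]
      by linarith
  qed
qed

text \<open>The blocks may be chosen independently. This permits a merely local minimum in the
  signal block next to global minima in all the others.\<close>

lemma local_minima_of_blocks:
  assumes "n \<le> d" "0 < n" "\<theta>s \<in> carrier_vec d" "separates d \<rho> \<rho>j" "0 \<le> lam"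
    and lm: "\<And>b. b < n div 2 \<Longrightarrow> block_local_min (block_objective n c s \<theta>s w \<rho>j lam b) (x b) (y b)"
  obtains \<theta> where "\<theta> \<in> local_minima (block_design n d c s) (response (block_design n d c s) \<theta>s w) \<rho> lam"
    "\<And>b. b < n div 2 \<Longrightarrow> \<theta> $ (2 * b) = x b \<and> \<theta> $ (2 * b + 1) = y b"
proof -
  let ?O = "objective (block_design n d c s) (response (block_design n d c s) \<theta>s w) \<rho> lam"
  let ?F = "block_objective n c s \<theta>s w \<rho>j lam"
  \<comment> \<open>Outside the blocks the value is 0, where every coordinate penalty is
    minimal.\<close>
  define \<theta> where "\<theta> = Matrix.vec d (\<lambda>i. if i < 2 * (n div 2) then (if even i then x (i div 2) else y (i div 2)) else 0)"
  have \<theta>: "\<theta> \<in> carrier_vec d" by (simp add: \<theta>_def)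
  have lt: "2 * b < d" "2 * b + 1 < d" if "b < n div 2" for b using that assms(1) by linarith+
  have at: "\<theta> $ (2 * b) = x b" "\<theta> $ (2 * b + 1) = y b" if "b < n div 2" for b
    using lt[OF that] that by (simp_all add: \<theta>_def)
  have "\<forall>b. \<exists>r>0. b < n div 2 \<longrightarrow> (\<forall>x' y'. \<bar>x' - x b\<bar> < r \<longrightarrow> \<bar>y' - y b\<bar> < r \<longrightarrow> ?F b (x b) (y b) \<le> ?F b x' y')"
  proof
    fix b
    show "\<exists>r>0. b < n div 2 \<longrightarrow> (\<forall>x' y'. \<bar>x' - x b\<bar> < r \<longrightarrow> \<bar>y' - y b\<bar> < r \<longrightarrow> ?F b (x b) (y b) \<le> ?F b x' y')"
    proof (cases "b < n div 2")
      case True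
      show ?thesis using lm[OF True] unfolding block_local_min_def by (simp only: True simp_thms)
    qed (simp add: exI[of _ 1])
  qed
  then obtain r where r: "\<And>b. r b > 0"
    "\<And>b x' y'. b < n div 2 \<Longrightarrow> \<bar>x' - x b\<bar> < r b \<Longrightarrow> \<bar>y' - y b\<bar> < r b \<Longrightarrow> ?F b (x b) (y b) \<le> ?F b x' y'"
    by metis
  \<comment> \<open>Inserting 1 keeps the set nonempty even when there is no block.\<close>
  define r0 where "r0 = Min (insert 1 (r ` {..<n div 2}))"
  have r0: "r0 > 0" "\<And>b. b < n div 2 \<Longrightarrow> r0 \<le> r b" using r(1) by (auto simp: r0_def)
  have "?O \<theta> \<le> ?O \<theta>'" if "\<theta>' \<in> open_ball d \<theta> r0" for \<theta>'
  proof -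
    have \<theta>': "\<theta>' \<in> carrier_vec d" "l2_norm (\<theta>' - \<theta>) < r0" using that by (auto simp: open_ball_def)
    have close: "\<bar>\<theta>' $ i - \<theta> $ i\<bar> < r0" if "i < d" for i
      using abs_index_le_l2_norm[of i "\<theta>' - \<theta>"] that \<theta> \<theta>' by simp
    have "(\<Sum>b<n div 2. ?F b (\<theta> $ (2 * b)) (\<theta> $ (2 * b + 1))) \<le> (\<Sum>b<n div 2. ?F b (\<theta>' $ (2 * b)) (\<theta>' $ (2 * b + 1)))"
    proof (intro sum_mono)
      fix b assume "b \<in> {..<n div 2}"
      then have b: "b < n div 2" by simp
      show "?F b (\<theta> $ (2 * b)) (\<theta> $ (2 * b + 1)) \<le> ?F b (\<theta>' $ (2 * b)) (\<theta>' $ (2 * b + 1))"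
        unfolding at[OF b] using close[OF lt(1)[OF b]] close[OF lt(2)[OF b]] r0(2)[OF b]
        unfolding at[OF b] by (intro r(2) b) linarith+
    qed
    moreover have "(\<Sum>j\<in>{2 * (n div 2)..<d}. lam * \<rho>j j (\<theta> $ j)) \<le> (\<Sum>j\<in>{2 * (n div 2)..<d}. lam * \<rho>j j (\<theta>' $ j))"
    proof (intro sum_mono mult_left_mono assms)
      fix j assume j: "j \<in> {2 * (n div 2)..<d}"
      then have em: "even_mono (\<rho>j j)" using assms(4) by (simp add: separates_def)
      have "\<theta> $ j = 0" using j by (simp add: \<theta>_def)
      then show "\<rho>j j (\<theta> $ j) \<le> \<rho>j j (\<theta>' $ j)" by (intro even_mono_le[OF em]) simp
    qed
    ultimately show ?thesis
      unfolding objective_block_design[OF assms(1-3) \<theta> assms(4)] objective_block_design[OF assms(1-3) \<theta>'(1) assms(4)]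
      by linarith
  qed
  then have "\<theta> \<in> local_minima (block_design n d c s) (response (block_design n d c s) \<theta>s w) \<rho> lam"
    using \<theta> r0(1) unfolding local_minima_def by auto
  then show ?thesis using that at by blast
qed

section \<open>The hard instance\<close>

text \<open>Only what the design may depend on is fixed here, with
  \<open>s\<^sup>2 * R = \<delta>\<close> as the tuning equation; the penalty, \<lambda>, the noise
  and the signal block stay free.\<close>

locale hard_instance =
  fixes n d :: nat and c s \<sigma> R \<delta> :: real
  assumes n4: "4 \<le> n" and nd: "n \<le> d" and s0: "0 < s" and sc: "s \<le> c" and cs1: "c\<^sup>2 + s\<^sup>2 = 1"
    and c78: "7 / 8 \<le> c" and \<sigma>0: "0 < \<sigma>" and \<delta>_eq: "\<delta> = \<sigma> / sqrt (real n)"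
    and R8: "8 * \<delta> \<le> R" and sR: "s\<^sup>2 * R = \<delta>"
begin

lemma n0: "0 < n" using n4 by simp

lemma \<delta>0: "0 < \<delta>" using \<sigma>0 n0 by (simp add: \<delta>_eq)

lemma c0: "0 < c" using s0 sc by simp

lemma s1: "s \<le> 1"
proof -
  have "s\<^sup>2 \<le> 1\<^sup>2" using cs1 zero_le_power2[of c] unfolding power_one by linarith
  then show ?thesis by (rule power2_le_imp_le) simp
qed

text \<open>Equal entries cancel in the strong difference row, so the signal shows only in the weak
  row of size s. It spends two nonzero entries and the entire l1 budget R.\<close>

definition signal :: "nat \<Rightarrow> real Matrix.vec" where
  "signal a = Matrix.vec d (\<lambda>i. if i div 2 = a then R / 2 else 0)"

lemma signal_carrier [simp]: "signal a \<in> carrier_vec d"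
  by (simp add: signal_def)

lemma signal_index:
  assumes "b < n div 2"
  shows "signal a $ (2 * b) = (if b = a then R / 2 else 0)" "signal a $ (2 * b + 1) = (if b = a then R / 2 else 0)"
proof -
  have "2 * b < d" "2 * b + 1 < d" using assms nd by linarith+
  then show "signal a $ (2 * b) = (if b = a then R / 2 else 0)" "signal a $ (2 * b + 1) = (if b = a then R / 2 else 0)"
    by (simp_all add: signal_def)
qed

lemma signal_bounds:
  assumes "2 \<le> k" "a < n div 2"
  shows "signal a \<in> B0 d k \<inter> B1 d R"
proof -
  have a: "{2 * a, 2 * a + 1} \<subseteq> {..<d}" using assms nd by auto
  have "{j. j < d \<and> signal a $ j \<noteq> 0} \<subseteq> {2 * a, 2 * a + 1}"
    by (auto simp: signal_def div_2_eq_iff split: if_splits)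
  then have "card {j. j < d \<and> signal a $ j \<noteq> 0} \<le> card {2 * a, 2 * a + 1}"
    by (intro card_mono) auto
  also have "\<dots> \<le> k" using assms by simp
  finally have 1: "signal a \<in> B0 d k" by (simp add: B0_def)
  have "l1_norm (signal a) = (\<Sum>i<d. \<bar>signal a $ i\<bar>)"
    by (simp add: l1_norm_def signal_def)
  also have "\<dots> = (\<Sum>i\<in>{2 * a, 2 * a + 1}. \<bar>signal a $ i\<bar>)"
    using a by (intro sum.mono_neutral_right) (auto simp: signal_def div_2_eq_iff)
  also have "\<dots> = R" using signal_index[OF assms(2), of a] R8 \<delta>0 by simp
  finally show ?thesis using 1 by (simp add: B1_def)
qed

text \<open>In s |q| the signal contributes s^2 R, which is \<delta> by the tuning, and quiet noise
  at most s \<delta> \<le> \<delta>.\<close>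

lemma block_pq_signal:
  assumes "a < n div 2" "\<bar>w (2 * a)\<bar> \<le> \<sigma>" "\<bar>w (2 * a + 1)\<bar> \<le> \<sigma>"
  shows "\<bar>block_p n c (signal a) w a\<bar> \<le> \<delta>" "s * \<bar>block_q n s (signal a) w a\<bar> \<le> 2 * \<delta>"
proof -
  have w: "\<bar>w i / sqrt (real n)\<bar> \<le> \<delta>" if "\<bar>w i\<bar> \<le> \<sigma>" for i
    using that by (simp add: \<delta>_eq divide_right_mono)
  show "\<bar>block_p n c (signal a) w a\<bar> \<le> \<delta>"
    using w[OF assms(2)] unfolding block_p_def signal_index[OF assms(1)] by simp
  have "s * \<bar>block_q n s (signal a) w a\<bar> = s * \<bar>s * R + w (2 * a + 1) / sqrt (real n)\<bar>"
    unfolding block_q_def signal_index[OF assms(1)] by simp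
  also have "\<dots> \<le> s * (\<bar>s * R\<bar> + \<bar>w (2 * a + 1) / sqrt (real n)\<bar>)"
    using s0 by (intro mult_left_mono abs_triangle_ineq) auto
  also have "\<dots> = s * \<bar>s * R\<bar> + s * \<bar>w (2 * a + 1) / sqrt (real n)\<bar>"
    by (rule distrib_left)
  also have "s * \<bar>s * R\<bar> = \<delta>"
  proof -
    have "\<bar>s * R\<bar> = s * R" using s0 R8 \<delta>0 by simp
    then show ?thesis using sR by (simp add: power2_eq_square)
  qed
  also have "s * \<bar>w (2 * a + 1) / sqrt (real n)\<bar> \<le> 1 * \<delta>"
    using s0 s1 w[OF assms(3)] by (intro mult_mono) auto
  finally show "s * \<bar>block_q n s (signal a) w a\<bar> \<le> 2 * \<delta>" by simp
qed

lemma block_pq_null: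
  assumes "b < n div 2" "b \<noteq> a" "10 * \<sigma> \<le> w (2 * b)" "w (2 * b) \<le> 11 * \<sigma>" "\<bar>w (2 * b + 1)\<bar> \<le> \<sigma>"
  shows "10 * \<delta> \<le> block_p n c (signal a) w b" "block_p n c (signal a) w b \<le> 11 * \<delta>"
    "\<bar>block_q n s (signal a) w b\<bar> \<le> \<delta>"
proof -
  have "block_p n c (signal a) w b = w (2 * b) / sqrt (real n)"
    "block_q n s (signal a) w b = w (2 * b + 1) / sqrt (real n)"
    unfolding block_p_def block_q_def signal_index[OF assms(1)] using assms(2) by simp_all
  then show "10 * \<delta> \<le> block_p n c (signal a) w b" "block_p n c (signal a) w b \<le> 11 * \<delta>"
    "\<bar>block_q n s (signal a) w b\<bar> \<le> \<delta>"
    using divide_right_mono[OF assms(3), of "sqrt (real n)"] divide_right_mono[OF assms(4), of "sqrt (real n)"]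
      divide_right_mono[OF assms(5), of "sqrt (real n)"] by (simp_all add: \<delta>_eq)
qed

text \<open>Block errors are nonnegative and add up, so either the signal block alone or the blocks
  in N alone suffice. The disjunction mirrors the two regimes of \<lambda>, and the minimum gives
  one bound free of \<lambda>.\<close>

lemma prediction_error_signal_ge:
  assumes a: "a < n div 2" and \<theta>: "\<theta> \<in> carrier_vec d" and N: "N \<subseteq> {..<n div 2} - {a}"
    and e: "9 / 32 * (s\<^sup>2 * R\<^sup>2) \<le> (c * (\<theta> $ (2 * a) - \<theta> $ (2 * a + 1)))\<^sup>2
          + (s * (\<theta> $ (2 * a) + \<theta> $ (2 * a + 1) - R))\<^sup>2 \<or>
        (\<forall>b\<in>N. \<delta>\<^sup>2 / 16 \<le> (c * (\<theta> $ (2 * b) - \<theta> $ (2 * b + 1)))\<^sup>2 + (s * (\<theta> $ (2 * b) + \<theta> $ (2 * b + 1)))\<^sup>2)"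
  shows "min (9 / 32 * (R * \<delta>)) (real (card N) * (\<delta>\<^sup>2 / 16)) \<le> prediction_error (block_design n d c s) (signal a) \<theta>"
proof -
  define E where "E b = (c * ((\<theta> $ (2 * b) - signal a $ (2 * b)) - (\<theta> $ (2 * b + 1) - signal a $ (2 * b + 1))))\<^sup>2
    + (s * ((\<theta> $ (2 * b) - signal a $ (2 * b)) + (\<theta> $ (2 * b + 1) - signal a $ (2 * b + 1))))\<^sup>2" for b
  have E0: "0 \<le> E b" for b by (simp add: E_def)
  have pe: "prediction_error (block_design n d c s) (signal a) \<theta> = (\<Sum>b<n div 2. E b)"
    unfolding E_def by (rule prediction_error_block_design[OF nd n0 signal_carrier \<theta>])
  have Ea: "E a = (c * (\<theta> $ (2 * a) - \<theta> $ (2 * a + 1)))\<^sup>2 + (s * (\<theta> $ (2 * a) + \<theta> $ (2 * a + 1) - R))\<^sup>2"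
    unfolding E_def signal_index[OF a] by simp
  have Eb: "E b = (c * (\<theta> $ (2 * b) - \<theta> $ (2 * b + 1)))\<^sup>2 + (s * (\<theta> $ (2 * b) + \<theta> $ (2 * b + 1)))\<^sup>2" if "b \<in> N" for b
  proof -
    have "b < n div 2" "b \<noteq> a" using that N by auto
    then show ?thesis unfolding E_def signal_index[OF \<open>b < n div 2\<close>] by simp
  qed
  from e show ?thesis
  proof
    assume e: "9 / 32 * (s\<^sup>2 * R\<^sup>2) \<le> (c * (\<theta> $ (2 * a) - \<theta> $ (2 * a + 1)))\<^sup>2
          + (s * (\<theta> $ (2 * a) + \<theta> $ (2 * a + 1) - R))\<^sup>2"
    have "s\<^sup>2 * R\<^sup>2 = R * \<delta>" using sR by (simp add: power2_eq_square mult.assoc mult.left_commute)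
    then have "9 / 32 * (R * \<delta>) \<le> E a" using e Ea by simp
    also have "\<dots> \<le> (\<Sum>b<n div 2. E b)" using a E0 by (intro member_le_sum) auto
    finally show ?thesis using pe by simp
  next
    assume e: "\<forall>b\<in>N. \<delta>\<^sup>2 / 16 \<le> (c * (\<theta> $ (2 * b) - \<theta> $ (2 * b + 1)))\<^sup>2 + (s * (\<theta> $ (2 * b) + \<theta> $ (2 * b + 1)))\<^sup>2"
    have "real (card N) * (\<delta>\<^sup>2 / 16) \<le> (\<Sum>b\<in>N. E b)"
      using e Eb by (intro sum_bounded_below) metis
    also have "\<dots> \<le> (\<Sum>b<n div 2. E b)" using N E0 by (intro sum_mono2) auto
    finally show ?thesis using pe by simp
  qed
qed

section \<open>Noise conditions and the dichotomy in \<lambda>\<close>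

definition quiet :: "nat \<Rightarrow> (nat \<Rightarrow> real) \<Rightarrow> bool" where
  "quiet a w \<longleftrightarrow> \<bar>w (2 * a)\<bar> \<le> \<sigma> \<and> \<bar>w (2 * a + 1)\<bar> \<le> \<sigma>"

definition noisy :: "nat \<Rightarrow> (nat \<Rightarrow> real) \<Rightarrow> bool" where
  "noisy b w \<longleftrightarrow> 10 * \<sigma> \<le> w (2 * b) \<and> w (2 * b) \<le> 11 * \<sigma> \<and> \<bar>w (2 * b + 1)\<bar> \<le> \<sigma>"

definition block_weight :: "(nat \<Rightarrow> real \<Rightarrow> real) \<Rightarrow> nat \<Rightarrow> real" where
  "block_weight \<rho>j b = max (\<rho>j (2 * b) \<delta>) (\<rho>j (2 * b + 1) \<delta>)"

lemma block_weight_scale: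
  "0 \<le> lam \<Longrightarrow> max (lam * \<rho>j (2 * b) \<delta>) (lam * \<rho>j (2 * b + 1) \<delta>) = lam * block_weight \<rho>j b"
  unfolding block_weight_def by (simp add: max_mult_distrib_left)

lemma separates_even_mono:
  assumes "separates d \<rho> \<rho>j" "b < n div 2" "0 \<le> lam"
  shows "even_mono (\<lambda>x. lam * \<rho>j (2 * b) x)" "even_mono (\<lambda>x. lam * \<rho>j (2 * b + 1) x)"
proof -
  have "2 * b < d" "2 * b + 1 < d" using assms nd by linarith+
  then show "even_mono (\<lambda>x. lam * \<rho>j (2 * b) x)" "even_mono (\<lambda>x. lam * \<rho>j (2 * b + 1) x)"
    using assms by (auto simp: separates_def intro: even_mono_scale)
qed

text \<open>A supremum over no minima would be 0, so an actual minimum has to be built for every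
  \<lambda>. Semicontinuity provides minimizers in all blocks; only under a heavy penalty does the
  signal block take the minimizer on the strip instead of a global one.\<close>

lemma exists_bad_local_minimum:
  assumes a: "a < n div 2" "\<And>b. b < n div 2 \<Longrightarrow> block_weight \<rho>j b \<le> block_weight \<rho>j a"
    and \<rho>: "separates d \<rho> \<rho>j" "lsc_penalty d \<rho>" and lam: "0 \<le> lam"
    and w: "quiet a w" "\<And>b. b \<in> N \<Longrightarrow> noisy b w" and N: "N \<subseteq> {..<n div 2} - {a}"
  obtains \<theta> where "\<theta> \<in> local_minima (block_design n d c s) (response (block_design n d c s) (signal a) w) \<rho> lam"
    "min (9 / 32 * (R * \<delta>)) (real (card N) * (\<delta>\<^sup>2 / 16)) \<le> prediction_error (block_design n d c s) (signal a) \<theta>"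
proof -
  let ?F = "block_objective n c s (signal a) w \<rho>j lam"
  have l: "lsc (\<lambda>x. lam * \<rho>j (2 * b) x)" "lsc (\<lambda>x. lam * \<rho>j (2 * b + 1) x)" if "b < n div 2" for b
  proof -
    have "2 * b < d" "2 * b + 1 < d" using that nd by linarith+
    then show "lsc (\<lambda>x. lam * \<rho>j (2 * b) x)" "lsc (\<lambda>x. lam * \<rho>j (2 * b + 1) x)"
      using lsc_penalty_coordinate[OF \<rho>] lam by (auto intro: lsc_scale)
  qed
  have global: "\<exists>x y. \<forall>x' y'. ?F b x y \<le> ?F b x' y'" if b: "b < n div 2" for b
  proof -
    obtain x y where "\<And>x' y'. ?F b x y \<le> ?F b x' y'"
      using block_min_exists[OF s0 c0 separates_even_mono[OF \<rho>(1) b lam] l[OF b], of UNIV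
          "block_p n c (signal a) w b" "block_q n s (signal a) w b"]
      unfolding block_objective_def by auto
    then show ?thesis by blast
  qed
  have lm: "block_local_min (?F b) x y" if "\<forall>x' y'. ?F b x y \<le> ?F b x' y'" for b x y
    using that unfolding block_local_min_def by (intro exI[of _ 1]) auto
  \<comment> \<open>What each block must deliver: the signal block is constrained only in the heavy
    regime, the blocks of N only in the light one.\<close>
  define good where "good b x y \<longleftrightarrow> (if b = a
    then 11 * \<delta>\<^sup>2 \<le> lam * block_weight \<rho>j a \<longrightarrow>
      9 / 32 * (s\<^sup>2 * R\<^sup>2) \<le> (c * (x - y))\<^sup>2 + (s * (x + y - R))\<^sup>2
    else \<not> 11 * \<delta>\<^sup>2 \<le> lam * block_weight \<rho>j a \<longrightarrow> b \<in> N \<longrightarrow>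
      \<delta>\<^sup>2 / 16 \<le> (c * (x - y))\<^sup>2 + (s * (x + y))\<^sup>2)" for b x y
  have "\<exists>x y. block_local_min (?F b) x y \<and> good b x y" if b: "b < n div 2" for b
  proof (cases "b = a \<and> 11 * \<delta>\<^sup>2 \<le> lam * block_weight \<rho>j a")
    case True
    have pq: "\<bar>block_p n c (signal a) w a\<bar> \<le> \<delta>" "s * \<bar>block_q n s (signal a) w a\<bar> \<le> 2 * \<delta>"
      using block_pq_signal[OF a(1)] w(1) by (auto simp: quiet_def)
    have "11 * \<delta>\<^sup>2 \<le> max (lam * \<rho>j (2 * a) \<delta>) (lam * \<rho>j (2 * a + 1) \<delta>)"
      unfolding block_weight_scale[OF lam] using True by simp
    then obtain x y where "block_local_min (?F a) x y"
      "9 / 32 * (s\<^sup>2 * R\<^sup>2) \<le> (c * (x - y))\<^sup>2 + (s * (x + y - R))\<^sup>2"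
      using signal_block_local_min[OF s0 sc cs1 separates_even_mono[OF \<rho>(1) a(1) lam] l[OF a(1)] \<delta>0 R8 pq]
      unfolding block_objective_def by blast
    then show ?thesis using True by (auto simp: good_def)
  next
    case False
    obtain x y where xy: "\<forall>x' y'. ?F b x y \<le> ?F b x' y'" using global[OF b] by blast
    have "\<delta>\<^sup>2 / 16 \<le> (c * (x - y))\<^sup>2 + (s * (x + y))\<^sup>2"
      if small: "\<not> 11 * \<delta>\<^sup>2 \<le> lam * block_weight \<rho>j a" and bN: "b \<in> N"
    proof -
      have ba: "b \<noteq> a" using bN N by auto
      \<comment> \<open>Maximality of block a passes the smallness of its penalty on to every null
        block.\<close>
      have "lam * block_weight \<rho>j b \<le> lam * block_weight \<rho>j a" using a(2)[OF b] lam by (intro mult_left_mono)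
      then have "max (lam * \<rho>j (2 * b) \<delta>) (lam * \<rho>j (2 * b + 1) \<delta>) < 11 * \<delta>\<^sup>2"
        unfolding block_weight_scale[OF lam] using small by linarith
      moreover have "10 * \<delta> \<le> block_p n c (signal a) w b" "block_p n c (signal a) w b \<le> 11 * \<delta>"
        "\<bar>block_q n s (signal a) w b\<bar> \<le> \<delta>"
        using block_pq_null[OF b ba] w(2)[OF bN] by (auto simp: noisy_def)
      ultimately show ?thesis
        using null_block_error[OF s0 cs1 c78 separates_even_mono[OF \<rho>(1) b lam] \<delta>0] xy
        unfolding block_objective_def by blast
    qed
    then have "good b x y" using False by (auto simp: good_def)
    then show ?thesis using lm[OF xy] by blast
  qed
  then obtain x y where xy: "\<And>b. b < n div 2 \<Longrightarrow> block_local_min (?F b) (x b) (y b)"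
    "\<And>b. b < n div 2 \<Longrightarrow> good b (x b) (y b)" by metis
  obtain \<theta> where \<theta>: "\<theta> \<in> local_minima (block_design n d c s) (response (block_design n d c s) (signal a) w) \<rho> lam"
    "\<And>b. b < n div 2 \<Longrightarrow> \<theta> $ (2 * b) = x b \<and> \<theta> $ (2 * b + 1) = y b"
    using local_minima_of_blocks[OF nd n0 signal_carrier \<rho>(1) lam xy(1)] by blast
  have g: "good b (\<theta> $ (2 * b)) (\<theta> $ (2 * b + 1))" if "b < n div 2" for b
    using xy(2)[OF that] \<theta>(2)[OF that] by simp
  have "min (9 / 32 * (R * \<delta>)) (real (card N) * (\<delta>\<^sup>2 / 16)) \<le> prediction_error (block_design n d c s) (signal a) \<theta>"
  proof (rule prediction_error_signal_ge[OF a(1) _ N])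
    show "\<theta> \<in> carrier_vec d" using \<theta>(1) by (simp add: local_minima_def)
    show "9 / 32 * (s\<^sup>2 * R\<^sup>2) \<le> (c * (\<theta> $ (2 * a) - \<theta> $ (2 * a + 1)))\<^sup>2
          + (s * (\<theta> $ (2 * a) + \<theta> $ (2 * a + 1) - R))\<^sup>2 \<or>
        (\<forall>b\<in>N. \<delta>\<^sup>2 / 16 \<le> (c * (\<theta> $ (2 * b) - \<theta> $ (2 * b + 1)))\<^sup>2 + (s * (\<theta> $ (2 * b) + \<theta> $ (2 * b + 1)))\<^sup>2)"
    proof (cases "11 * \<delta>\<^sup>2 \<le> lam * block_weight \<rho>j a")
      case True
      then show ?thesis using g[OF a(1)] by (simp add: good_def)
    next
      case False
      have "\<delta>\<^sup>2 / 16 \<le> (c * (\<theta> $ (2 * b) - \<theta> $ (2 * b + 1)))\<^sup>2 + (s * (\<theta> $ (2 * b) + \<theta> $ (2 * b + 1)))\<^sup>2"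
        if "b \<in> N" for b
      proof -
        have "b < n div 2" "b \<noteq> a" using that N by auto
        then show ?thesis using g[of b] False that by (simp add: good_def)
      qed
      then show ?thesis by blast
    qed
  qed
  with \<theta>(1) show ?thesis using that by blast
qed

text \<open>Convexity makes each block of a local minimum a global minimizer of its block objective,
  so the same two block estimates apply to every local minimum.\<close>

lemma all_local_minima_bad:
  assumes a: "a < n div 2" "\<And>b. b < n div 2 \<Longrightarrow> block_weight \<rho>j b \<le> block_weight \<rho>j a"
    and \<rho>: "separates d \<rho> \<rho>j" "convex_penalty d \<rho>" and lam: "0 \<le> lam"
    and w: "quiet a w" "\<And>b. b \<in> N \<Longrightarrow> noisy b w" and N: "N \<subseteq> {..<n div 2} - {a}"
    and \<theta>: "\<theta> \<in> local_minima (block_design n d c s) (response (block_design n d c s) (signal a) w) \<rho> lam"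
  shows "min (9 / 32 * (R * \<delta>)) (real (card N) * (\<delta>\<^sup>2 / 16)) \<le> prediction_error (block_design n d c s) (signal a) \<theta>"
proof (rule prediction_error_signal_ge[OF a(1) _ N])
  let ?F = "block_objective n c s (signal a) w \<rho>j lam"
  show "\<theta> \<in> carrier_vec d" using \<theta> by (simp add: local_minima_def)
  have cv: "convex_on UNIV (\<lambda>x. lam * \<rho>j (2 * b) x)" "convex_on UNIV (\<lambda>x. lam * \<rho>j (2 * b + 1) x)" if "b < n div 2" for b
  proof -
    have "2 * b < d" "2 * b + 1 < d" using that nd by linarith+
    then show "convex_on UNIV (\<lambda>x. lam * \<rho>j (2 * b) x)" "convex_on UNIV (\<lambda>x. lam * \<rho>j (2 * b + 1) x)"
      using convex_penalty_coordinate[OF \<rho>] lam by (auto intro: convex_on_cmul)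
  qed
  have min: "?F b (\<theta> $ (2 * b)) (\<theta> $ (2 * b + 1)) \<le> ?F b x' y'" if b: "b < n div 2" for b x' y'
    using local_minima_block[OF nd n0 signal_carrier \<rho>(1) \<theta> b]
    unfolding block_objective_def by (rule block_local_min_convex[OF cv[OF b]])
  show "9 / 32 * (s\<^sup>2 * R\<^sup>2) \<le> (c * (\<theta> $ (2 * a) - \<theta> $ (2 * a + 1)))\<^sup>2
        + (s * (\<theta> $ (2 * a) + \<theta> $ (2 * a + 1) - R))\<^sup>2 \<or>
      (\<forall>b\<in>N. \<delta>\<^sup>2 / 16 \<le> (c * (\<theta> $ (2 * b) - \<theta> $ (2 * b + 1)))\<^sup>2 + (s * (\<theta> $ (2 * b) + \<theta> $ (2 * b + 1)))\<^sup>2)"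
  proof (cases "11 * \<delta>\<^sup>2 \<le> lam * block_weight \<rho>j a")
    case True
    then have "11 * \<delta>\<^sup>2 \<le> max (lam * \<rho>j (2 * a) \<delta>) (lam * \<rho>j (2 * a + 1) \<delta>)"
      unfolding block_weight_scale[OF lam] by simp
    moreover have "\<bar>block_p n c (signal a) w a\<bar> \<le> \<delta>" "s * \<bar>block_q n s (signal a) w a\<bar> \<le> 2 * \<delta>"
      using block_pq_signal[OF a(1)] w(1) by (auto simp: quiet_def)
    ultimately show ?thesis
      using signal_block_convex[OF s0 sc cs1 separates_even_mono[OF \<rho>(1) a(1) lam] cv[OF a(1)] \<delta>0 R8] min[OF a(1)]
      unfolding block_objective_def by blast
  next
    case False
    have "\<delta>\<^sup>2 / 16 \<le> (c * (\<theta> $ (2 * b) - \<theta> $ (2 * b + 1)))\<^sup>2 + (s * (\<theta> $ (2 * b) + \<theta> $ (2 * b + 1)))\<^sup>2"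
      if bN: "b \<in> N" for b
    proof -
      have b: "b < n div 2" and ba: "b \<noteq> a" using bN N by auto
      have "lam * block_weight \<rho>j b \<le> lam * block_weight \<rho>j a" using a(2)[OF b] lam by (intro mult_left_mono)
      then have "max (lam * \<rho>j (2 * b) \<delta>) (lam * \<rho>j (2 * b + 1) \<delta>) < 11 * \<delta>\<^sup>2"
        unfolding block_weight_scale[OF lam] using False by linarith
      moreover have "10 * \<delta> \<le> block_p n c (signal a) w b" "block_p n c (signal a) w b \<le> 11 * \<delta>"
        "\<bar>block_q n s (signal a) w b\<bar> \<le> \<delta>"
        using block_pq_null[OF b ba] w(2)[OF bN] by (auto simp: noisy_def)
      ultimately show ?thesis
        using null_block_error[OF s0 cs1 c78 separates_even_mono[OF \<rho>(1) b lam] \<delta>0] min[OF b]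
        unfolding block_objective_def by blast
    qed
    then show ?thesis by blast
  qed
qed

end

section \<open>Gaussian noise\<close>

text \<open>The constant is \<open>\<sigma>\<close> times the normal density at \<open>11 \<sigma>\<close>.\<close>

lemma emeasure_gaussian_window:
  fixes \<sigma> a b :: real
  assumes "0 < \<sigma>" "\<bar>a\<bar> \<le> 11 * \<sigma>" "\<bar>b\<bar> \<le> 11 * \<sigma>" "b - a = \<sigma>"
  shows "ennreal (exp (- (121 / 2)) / sqrt (2 * pi)) \<le> emeasure (density lborel (\<lambda>x. ennreal (normal_density 0 \<sigma> x))) {a..b}"
proof -
  let ?p = "exp (- (121 / 2)) / sqrt (2 * pi)"
  have p: "0 \<le> ?p" by simp
  have lower: "?p / \<sigma> \<le> normal_density 0 \<sigma> x" if "x \<in> {a..b}" for x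
  proof -
    have "\<bar>x\<bar> \<le> 11 * \<sigma>" using that assms by auto
    then have "x\<^sup>2 \<le> (11 * \<sigma>)\<^sup>2" using assms(1) by (metis abs_le_square_iff abs_of_nonneg less_imp_le mult_nonneg_nonneg zero_le_numeral)
    then have "x\<^sup>2 / (2 * \<sigma>\<^sup>2) \<le> 121 / 2" using assms(1) by (simp add: field_simps power_mult_distrib)
    then have "exp (- (121 / 2)) \<le> exp (- x\<^sup>2 / (2 * \<sigma>\<^sup>2))" by simp
    moreover have "sqrt (2 * pi * \<sigma>\<^sup>2) = sqrt (2 * pi) * \<sigma>" using assms(1) by (simp add: real_sqrt_mult)
    ultimately show ?thesis using assms(1)
      unfolding normal_density_def by (simp add: divide_simps)
  qed
  have "ennreal ?p = ennreal (?p / \<sigma>) * ennreal \<sigma>" using assms(1) p by (simp flip: ennreal_mult)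
  also have "\<dots> = (\<integral>\<^sup>+ x. ennreal (?p / \<sigma>) * indicator {a..b} x \<partial>lborel)"
    using assms by (subst nn_integral_cmult_indicator) auto
  also have "\<dots> \<le> (\<integral>\<^sup>+ x. ennreal (normal_density 0 \<sigma> x) * indicator {a..b} x \<partial>lborel)"
  proof (rule nn_integral_mono)
    fix x
    show "ennreal (?p / \<sigma>) * indicator {a..b} x \<le> ennreal (normal_density 0 \<sigma> x) * indicator {a..b} x"
      using ennreal_leI[OF lower, of x] by (cases "x \<in> {a..b}") simp_all
  qed
  also have "\<dots> = emeasure (density lborel (\<lambda>x. ennreal (normal_density 0 \<sigma> x))) {a..b}"
    by (subst emeasure_density) auto
  finally show ?thesis .
qed

lemma emeasure_gaussian_noise_box:
  assumes "0 < \<sigma>" "\<And>i. i < n \<Longrightarrow> A i \<in> sets borel"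
  shows "emeasure (gaussian_noise n \<sigma>) (Pi\<^sub>E {..<n} A)
    = (\<Prod>i<n. emeasure (density lborel (\<lambda>x. ennreal (normal_density 0 \<sigma> x))) (A i))"
proof -
  interpret prob_space "density lborel (\<lambda>x. ennreal (normal_density 0 \<sigma> x))"
    using assms(1) by (rule prob_space_normal_density)
  interpret product_sigma_finite "\<lambda>_::nat. density lborel (\<lambda>x. ennreal (normal_density 0 \<sigma> x))"
    by unfold_locales
  show ?thesis unfolding gaussian_noise_def using assms(2) by (intro emeasure_PiM) auto
qed

section \<open>Window events for the noise\<close>

context hard_instance
begin

text \<open>A measurable product set inside the quiet and noisy conditions. With {0..\<sigma>} in
  place of the symmetric interval, all four windows have length \<sigma> and share one density
  bound.\<close>

definition window_box :: "nat \<Rightarrow> nat \<Rightarrow> (nat \<Rightarrow> real) set" where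
  "window_box a b = Pi\<^sub>E {..<n} (\<lambda>i. if i = 2 * b then {10 * \<sigma>..11 * \<sigma>}
     else if i \<in> {2 * b + 1, 2 * a, 2 * a + 1} then {0..\<sigma>} else UNIV)"

lemma window_box_sets: "window_box a b \<in> sets (gaussian_noise n \<sigma>)"
  unfolding window_box_def gaussian_noise_def by (intro sets_PiM_I_finite) auto

lemma window_boxD:
  assumes "w \<in> window_box a b" "a < n div 2" "b < n div 2" "b \<noteq> a"
  shows "quiet a w" "noisy b w"
proof -
  have lt: "2 * a < n" "2 * a + 1 < n" "2 * b < n" "2 * b + 1 < n" using assms by linarith+
  have ne: "2 * a + 1 \<noteq> 2 * b" "2 * b + 1 \<noteq> 2 * b" "2 * a \<noteq> 2 * b" using assms(4) by presburger+
  have w: "w i \<in> (if i = 2 * b then {10 * \<sigma>..11 * \<sigma>}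
     else if i \<in> {2 * b + 1, 2 * a, 2 * a + 1} then {0..\<sigma>} else UNIV)" if "i < n" for i
    by (rule PiE_mem[OF assms(1)[unfolded window_box_def]]) (use that in simp)
  show "quiet a w" using w[OF lt(1)] w[OF lt(2)] ne unfolding quiet_def by auto
  show "noisy b w" using w[OF lt(3)] w[OF lt(4)] ne unfolding noisy_def by auto
qed

text \<open>The four restricted coordinates are distinct as b \<noteq> a, so independence gives a
  fourth power; the unrestricted ones contribute factors 1.\<close>

lemma emeasure_window_box:
  assumes "a < n div 2" "b < n div 2" "b \<noteq> a"
  shows "ennreal ((exp (- (121 / 2)) / sqrt (2 * pi)) ^ 4) \<le> emeasure (gaussian_noise n \<sigma>) (window_box a b)"
proof -
  let ?p = "exp (- (121 / 2)) / sqrt (2 * pi)"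
  let ?M = "density lborel (\<lambda>x. ennreal (normal_density 0 \<sigma> x))"
  let ?A = "\<lambda>i. if i = 2 * b then {10 * \<sigma>..11 * \<sigma>}
     else if i \<in> {2 * b + 1, 2 * a, 2 * a + 1} then {0..\<sigma>} else UNIV"
  let ?S = "{2 * b, 2 * b + 1, 2 * a, 2 * a + 1}"
  interpret prob_space ?M using \<sigma>0 by (rule prob_space_normal_density)
  have S: "?S \<subseteq> {..<n}" using assms by auto
  have ne: "2 * a + 1 \<noteq> 2 * b" "2 * b + 1 \<noteq> 2 * a" "2 * a \<noteq> 2 * b" using assms(3) by presburger+
  then have card: "card ?S = 4" using assms(3) by simp
  have window: "ennreal ?p \<le> emeasure ?M (?A i)" if "i \<in> ?S" for i
  proof (cases "i = 2 * b")
    case True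
    then have "?A i = {10 * \<sigma>..11 * \<sigma>}" by simp
    moreover have "ennreal ?p \<le> emeasure ?M {10 * \<sigma>..11 * \<sigma>}"
      using \<sigma>0 by (intro emeasure_gaussian_window) simp_all
    ultimately show ?thesis by (simp only:)
  next
    case False
    then have "?A i = {0..\<sigma>}" using that by simp
    moreover have "ennreal ?p \<le> emeasure ?M {0..\<sigma>}"
      using \<sigma>0 by (intro emeasure_gaussian_window) simp_all
    ultimately show ?thesis by (simp only:)
  qed
  have "ennreal (?p ^ 4) = (\<Prod>i\<in>?S. ennreal ?p)"
    unfolding prod_constant card by (simp add: ennreal_power)
  also have "\<dots> \<le> (\<Prod>i\<in>?S. emeasure ?M (?A i))"
    by (intro prod_mono_ennreal window)
  also have "\<dots> = (\<Prod>i<n. emeasure ?M (?A i))"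
    using S emeasure_space_1 by (intro prod.mono_neutral_left) auto
  also have "\<dots> = emeasure (gaussian_noise n \<sigma>) (window_box a b)"
    unfolding window_box_def by (rule emeasure_gaussian_noise_box[symmetric]) (use \<sigma>0 in auto)
  finally show ?thesis .
qed

text \<open>
  The count of noisy blocks enters only through its expectation, since
  \<open>min A (N * B) \<ge> N * min A (M * B) / M\<close> whenever \<open>N \<le> M\<close>.
\<close>

lemma risk_ge:
  assumes a: "a < n div 2" and AB: "0 \<le> A" "0 \<le> B"
    and f: "\<And>w N. quiet a w \<Longrightarrow> N \<subseteq> {..<n div 2} - {a} \<Longrightarrow> (\<And>b. b \<in> N \<Longrightarrow> noisy b w) \<Longrightarrow>
      ennreal (min A (real (card N) * B)) \<le> f w"
  shows "ennreal ((exp (- (121 / 2)) / sqrt (2 * pi)) ^ 4 * min A ((real (n div 2) - 1) * B))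
    \<le> (\<integral>\<^sup>+ w. f w \<partial>gaussian_noise n \<sigma>)"
proof -
  let ?p = "(exp (- (121 / 2)) / sqrt (2 * pi)) ^ 4"
  let ?B = "{..<n div 2} - {a}"
  define M where "M = real (n div 2) - 1"
  define \<kappa> where "\<kappa> = min A (M * B) / M"
  have M: "M = real (card ?B)" using a by (simp add: M_def of_nat_diff)
  \<comment> \<open>At least one null block remains beside the signal block, so division by M is
    legitimate.\<close>
  have "2 \<le> n div 2" using n4 by simp
  then have M0: "0 < M" by (simp add: M_def)
  have \<kappa>: "0 \<le> \<kappa>" using AB M0 by (simp add: \<kappa>_def)
  have p0: "0 \<le> ?p" by simp
  have "ennreal (?p * min A (M * B)) = (\<Sum>b\<in>?B. ennreal \<kappa> * ennreal ?p)"
  proof -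
    have "(\<Sum>b\<in>?B. ennreal \<kappa> * ennreal ?p) = (\<Sum>b\<in>?B. ennreal (\<kappa> * ?p))"
      using \<kappa> p0 by (simp only: ennreal_mult)
    also have "\<dots> = ennreal (\<Sum>b\<in>?B. \<kappa> * ?p)" using \<kappa> p0 by (intro sum_ennreal mult_nonneg_nonneg)
    also have "(\<Sum>b\<in>?B. \<kappa> * ?p) = M * (\<kappa> * ?p)" unfolding M by simp
    also have "\<dots> = ?p * min A (M * B)" using M0 by (simp add: \<kappa>_def)
    finally show ?thesis by simp
  qed
  also have "\<dots> \<le> (\<Sum>b\<in>?B. ennreal \<kappa> * emeasure (gaussian_noise n \<sigma>) (window_box a b))"
    using a by (intro sum_mono mult_left_mono emeasure_window_box) auto
  \<comment> \<open>The integrand f need not be measurable; integral and sum are exchanged only for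
    this minorant made of indicators of boxes.\<close>
  also have "\<dots> = (\<integral>\<^sup>+ w. (\<Sum>b\<in>?B. ennreal \<kappa> * indicator (window_box a b) w) \<partial>gaussian_noise n \<sigma>)"
    using window_box_sets by (subst nn_integral_sum) (auto simp: nn_integral_cmult_indicator)
  also have "\<dots> \<le> (\<integral>\<^sup>+ w. f w \<partial>gaussian_noise n \<sigma>)"
  proof (intro nn_integral_mono)
    fix w
    define N where "N = {b \<in> ?B. w \<in> window_box a b}"
    have N: "N \<subseteq> ?B" by (auto simp: N_def)
    then have fin: "finite N" and cN: "real (card N) \<le> M" unfolding M
      by (auto intro: finite_subset card_mono)
    have "(\<Sum>b\<in>?B. ennreal \<kappa> * indicator (window_box a b) w) = (\<Sum>b\<in>N. ennreal \<kappa>)"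
      unfolding N_def by (intro sum.mono_neutral_cong_right) (auto simp: indicator_def)
    also have "\<dots> = ennreal (real (card N) * \<kappa>)" using \<kappa> by (simp add: ennreal_mult ennreal_of_nat_eq_real_of_nat)
    also have "\<dots> \<le> f w"
    \<comment> \<open>Quietness of the signal block is read off from any box containing w; if there
      is none, the minorant vanishes at w.\<close>
    proof (cases "N = {}")
      case False
      then obtain b where "b \<in> N" by blast
      then have "quiet a w" using window_boxD(1)[of w a b] a by (auto simp: N_def)
      moreover have "noisy b w" if "b \<in> N" for b using window_boxD(2)[of w a b] a that by (auto simp: N_def)
      ultimately have "ennreal (min A (real (card N) * B)) \<le> f w" using f N by blast
      moreover have "real (card N) * \<kappa> \<le> min A (real (card N) * B)"
      proof (rule min.boundedI)
        have "real (card N) * \<kappa> \<le> M * \<kappa>" using cN \<kappa> by (intro mult_right_mono)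
        also have "\<dots> \<le> A" using M0 by (simp add: \<kappa>_def)
        finally show "real (card N) * \<kappa> \<le> A" .
        have "\<kappa> \<le> M * B / M" unfolding \<kappa>_def using M0 by (intro divide_right_mono) auto
        then show "real (card N) * \<kappa> \<le> real (card N) * B" using M0 by (intro mult_left_mono) auto
      qed
      ultimately show ?thesis by (meson ennreal_leI order_trans)
    qed simp
    finally show "(\<Sum>b\<in>?B. ennreal \<kappa> * indicator (window_box a b) w) \<le> f w" .
  qed
  finally show ?thesis by (simp add: M_def)
qed

section \<open>Lower bounds for the two risks\<close>

lemma heaviest_block:
  obtains a where "a < n div 2" "\<And>b. b < n div 2 \<Longrightarrow> block_weight \<rho>j b \<le> block_weight \<rho>j a"
proof -
  let ?H = "block_weight \<rho>j ` {..<n div 2}"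
  have "0 < n div 2" using n4 by simp
  then have "Max ?H \<in> ?H" by (intro Max_in) auto
  then obtain a where "a < n div 2" "block_weight \<rho>j a = Max ?H" by auto
  then show ?thesis using that[of a] by simp
qed

lemma sup_worst_local_risk_ge:
  assumes "2 \<le> k" "\<rho> \<in> separable_penalties d" "lsc_penalty d \<rho>"
  shows "ennreal ((exp (- (121 / 2)) / sqrt (2 * pi)) ^ 4 * min (9 / 32 * (R * \<delta>)) ((real (n div 2) - 1) * (\<delta>\<^sup>2 / 16)))
    \<le> (SUP \<theta>s\<in>B0 d k \<inter> B1 d R. worst_local_risk (block_design n d c s) \<sigma> \<rho> \<theta>s)"
proof -
  obtain \<rho>j where \<rho>j: "separates d \<rho> \<rho>j" using separable_penalties_separates[OF assms(2)] by blast
  \<comment> \<open>This choice depends on \<rho> alone, neither on \<lambda> nor on the noise, so a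
    single signal serves under the whole expectation.\<close>
  obtain a where a: "a < n div 2" "\<And>b. b < n div 2 \<Longrightarrow> block_weight \<rho>j b \<le> block_weight \<rho>j a"
    using heaviest_block by blast
  show ?thesis
  proof (rule SUP_upper2[OF signal_bounds[OF assms(1) a(1)]])
    show "ennreal ((exp (- (121 / 2)) / sqrt (2 * pi)) ^ 4 * min (9 / 32 * (R * \<delta>)) ((real (n div 2) - 1) * (\<delta>\<^sup>2 / 16)))
      \<le> worst_local_risk (block_design n d c s) \<sigma> \<rho> (signal a)"
      unfolding worst_local_risk_def block_design_dims
    proof (rule risk_ge[OF a(1)])
      fix w N
      assume w: "quiet a w" "N \<subseteq> {..<n div 2} - {a}" "\<And>b. b \<in> N \<Longrightarrow> noisy b w"
      show "ennreal (min (9 / 32 * (R * \<delta>)) (real (card N) * (\<delta>\<^sup>2 / 16)))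
        \<le> (INF lam\<in>{0..}. SUP \<theta>\<in>local_minima (block_design n d c s) (response (block_design n d c s) (signal a) w) \<rho> lam.
          ennreal (prediction_error (block_design n d c s) (signal a) \<theta>))"
      proof (rule INF_greatest)
        fix lam :: real assume "lam \<in> {0..}"
        then have "0 \<le> lam" by simp
        then obtain \<theta> where "\<theta> \<in> local_minima (block_design n d c s) (response (block_design n d c s) (signal a) w) \<rho> lam"
          "min (9 / 32 * (R * \<delta>)) (real (card N) * (\<delta>\<^sup>2 / 16)) \<le> prediction_error (block_design n d c s) (signal a) \<theta>"
          using exists_bad_local_minimum[OF a \<rho>j assms(3) _ w(1,3,2)] by blast
        then show "ennreal (min (9 / 32 * (R * \<delta>)) (real (card N) * (\<delta>\<^sup>2 / 16)))
          \<le> (SUP \<theta>\<in>local_minima (block_design n d c s) (response (block_design n d c s) (signal a) w) \<rho> lam.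
            ennreal (prediction_error (block_design n d c s) (signal a) \<theta>))"
          by (intro SUP_upper2 ennreal_leI)
      qed
    qed (use \<delta>0 R8 in auto)
  qed
qed

lemma sup_best_local_risk_ge:
  assumes "2 \<le> k" "\<rho> \<in> separable_penalties d" "convex_penalty d \<rho>"
  shows "ennreal ((exp (- (121 / 2)) / sqrt (2 * pi)) ^ 4 * min (9 / 32 * (R * \<delta>)) ((real (n div 2) - 1) * (\<delta>\<^sup>2 / 16)))
    \<le> (SUP \<theta>s\<in>B0 d k \<inter> B1 d R. best_local_risk (block_design n d c s) \<sigma> \<rho> \<theta>s)"
proof -
  obtain \<rho>j where \<rho>j: "separates d \<rho> \<rho>j" using separable_penalties_separates[OF assms(2)] by blast
  obtain a where a: "a < n div 2" "\<And>b. b < n div 2 \<Longrightarrow> block_weight \<rho>j b \<le> block_weight \<rho>j a"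
    using heaviest_block by blast
  show ?thesis
  proof (rule SUP_upper2[OF signal_bounds[OF assms(1) a(1)]])
    show "ennreal ((exp (- (121 / 2)) / sqrt (2 * pi)) ^ 4 * min (9 / 32 * (R * \<delta>)) ((real (n div 2) - 1) * (\<delta>\<^sup>2 / 16)))
      \<le> best_local_risk (block_design n d c s) \<sigma> \<rho> (signal a)"
      unfolding best_local_risk_def block_design_dims
    proof (rule risk_ge[OF a(1)])
      fix w N
      assume w: "quiet a w" "N \<subseteq> {..<n div 2} - {a}" "\<And>b. b \<in> N \<Longrightarrow> noisy b w"
      show "ennreal (min (9 / 32 * (R * \<delta>)) (real (card N) * (\<delta>\<^sup>2 / 16)))
        \<le> (INF lam\<in>{0..}. INF \<theta>\<in>local_minima (block_design n d c s) (response (block_design n d c s) (signal a) w) \<rho> lam.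
          ennreal (prediction_error (block_design n d c s) (signal a) \<theta>))"
        \<comment> \<open>An empty set of local minima is harmless here, its infimum being
          infinite.\<close>
        by (intro INF_greatest ennreal_leI all_local_minima_bad[OF a \<rho>j assms(3) _ w(1,3,2)]) auto
    qed (use \<delta>0 R8 in auto)
  qed
qed

text \<open>The sum over null blocks decides the constant: \<sigma>^2 = n \<delta>^2, at least n/8
  blocks are null, and each contributes \<delta>^2/16, whence 128 = 8 * 16.\<close>

lemma rate_le:
  "min (\<sigma>\<^sup>2) (\<sigma> * R / sqrt (real n)) / 128 \<le> min (9 / 32 * (R * \<delta>)) ((real (n div 2) - 1) * (\<delta>\<^sup>2 / 16))"
proof (rule min.boundedI)
  have R: "\<sigma> * R / sqrt (real n) = R * \<delta>" by (simp add: \<delta>_eq)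
  have "0 \<le> R * \<delta>" using R8 \<delta>0 by simp
  then show "min (\<sigma>\<^sup>2) (\<sigma> * R / sqrt (real n)) / 128 \<le> 9 / 32 * (R * \<delta>)" unfolding R by linarith
  have \<sigma>: "\<sigma>\<^sup>2 = real n * \<delta>\<^sup>2" using n0 by (simp add: \<delta>_eq power_divide)
  \<comment> \<open>This absorbs both the rounding of n/2 and the loss of the signal block.\<close>
  have "n + 8 \<le> 8 * (n div 2)" using n4 by presburger
  then have "real (n + 8) \<le> real (8 * (n div 2))" by (simp only: of_nat_le_iff)
  then have "real n \<le> 8 * (real (n div 2) - 1)" by simp
  then have "real n * \<delta>\<^sup>2 \<le> 8 * (real (n div 2) - 1) * \<delta>\<^sup>2" by (intro mult_right_mono) auto
  moreover have "min (\<sigma>\<^sup>2) (\<sigma> * R / sqrt (real n)) \<le> real n * \<delta>\<^sup>2"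
    unfolding \<sigma>[symmetric] by (rule min.cobounded1)
  ultimately have "min (\<sigma>\<^sup>2) (\<sigma> * R / sqrt (real n)) / 128 \<le> 8 * (real (n div 2) - 1) * \<delta>\<^sup>2 / 128"
    by (intro divide_right_mono) simp_all
  also have "\<dots> = (real (n div 2) - 1) * (\<delta>\<^sup>2 / 16)" by simp
  finally show "min (\<sigma>\<^sup>2) (\<sigma> * R / sqrt (real n)) / 128 \<le> (real (n div 2) - 1) * (\<delta>\<^sup>2 / 16)" .
qed

end

section \<open>Choice of parameters and conclusion\<close>

lemma hard_instance_exists:
  assumes "0 < \<sigma>" "4 \<le> n" "n \<le> d" "8 * \<sigma> / sqrt (real n) \<le> R"
  obtains c s where "hard_instance n d c s \<sigma> R (\<sigma> / sqrt (real n))"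
proof -
  define \<delta> where "\<delta> = \<sigma> / sqrt (real n)"
  have \<delta>: "0 < \<delta>" "8 * \<delta> \<le> R" using assms by (simp_all add: \<delta>_def)
  \<comment> \<open>t is the square of s; the lower bound on R becomes t \<le> 1/8.\<close>
  define t where "t = \<delta> / R"
  have t: "0 < t" "t \<le> 1 / 8" "t * R = \<delta>" using \<delta> by (simp_all add: t_def field_simps)
  have "hard_instance n d (sqrt (1 - t)) (sqrt t) \<sigma> R \<delta>"
  proof
    \<comment> \<open>Here 49/64 \<le> 7/8 \<le> 1 - t.\<close>
    have "(7 / 8)\<^sup>2 \<le> 1 - t" using t by (simp add: power2_eq_square)
    then show "7 / 8 \<le> sqrt (1 - t)" by (rule real_le_rsqrt)
  qed (use t \<delta> assms in \<open>simp_all add: \<delta>_def\<close>)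
  then show ?thesis using that by (simp add: \<delta>_def)
qed

theorem theorem1:
  shows "\<exists>c::real. c > 0 \<and>
    (\<forall>(\<sigma>::real) (n::nat) (d::nat) (k::nat) (R::real).
       \<sigma> > 0 \<longrightarrow> d \<ge> n \<longrightarrow> n \<ge> 4 \<longrightarrow> k \<ge> 2 \<longrightarrow> R \<ge> 8 * \<sigma> / sqrt (real n) \<longrightarrow>
       (\<exists>X \<in> carrier_mat n d.
          (\<forall>j<d. l2_norm (col X j) / sqrt (real n) \<le> 1) \<and>
          (\<forall>\<rho> \<in> separable_penalties d. lsc_penalty d \<rho> \<longrightarrow>
             (SUP \<theta>s \<in> B0 d k \<inter> B1 d R. worst_local_risk X \<sigma> \<rho> \<theta>s)
               \<ge> ennreal (c * min (\<sigma>\<^sup>2) (\<sigma> * R / sqrt (real n)))) \<and>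
          (\<forall>\<rho> \<in> separable_penalties d. convex_penalty d \<rho> \<longrightarrow>
             (SUP \<theta>s \<in> B0 d k \<inter> B1 d R. best_local_risk X \<sigma> \<rho> \<theta>s)
               \<ge> ennreal (c * min (\<sigma>\<^sup>2) (\<sigma> * R / sqrt (real n))))))"
proof (intro exI conjI allI impI)
  let ?p = "(exp (- (121 / 2)) / sqrt (2 * pi)) ^ 4 :: real"
  \<comment> \<open>The fourth power is the price of the four noise windows, and 128 comes from
    \<open>rate_le\<close>.\<close>
  show "0 < ?p / 128" by simp
  fix \<sigma> R :: real and n d k :: nat
  assume \<sigma>: "\<sigma> > 0" and nd: "d \<ge> n" and n: "n \<ge> 4" and k: "k \<ge> 2" and R: "R \<ge> 8 * \<sigma> / sqrt (real n)"
  obtain c s where "hard_instance n d c s \<sigma> R (\<sigma> / sqrt (real n))"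
    using hard_instance_exists[OF \<sigma> n nd R] by blast
  then interpret hard_instance n d c s \<sigma> R "\<sigma> / sqrt (real n)" .
  have rate: "ennreal (?p / 128 * min (\<sigma>\<^sup>2) (\<sigma> * R / sqrt (real n))) \<le> ennreal (?p * min (9 / 32 * (R * (\<sigma> / sqrt (real n))))
      ((real (n div 2) - 1) * ((\<sigma> / sqrt (real n))\<^sup>2 / 16)))"
  proof (rule ennreal_leI)
    have "?p * (min (\<sigma>\<^sup>2) (\<sigma> * R / sqrt (real n)) / 128) \<le> ?p * min (9 / 32 * (R * (\<sigma> / sqrt (real n))))
      ((real (n div 2) - 1) * ((\<sigma> / sqrt (real n))\<^sup>2 / 16))"
      by (intro mult_left_mono rate_le) simp
    then show "?p / 128 * min (\<sigma>\<^sup>2) (\<sigma> * R / sqrt (real n)) \<le> ?p * min (9 / 32 * (R * (\<sigma> / sqrt (real n))))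
      ((real (n div 2) - 1) * ((\<sigma> / sqrt (real n))\<^sup>2 / 16))" by simp
  qed
  show "\<exists>X \<in> carrier_mat n d.
          (\<forall>j<d. l2_norm (col X j) / sqrt (real n) \<le> 1) \<and>
          (\<forall>\<rho> \<in> separable_penalties d. lsc_penalty d \<rho> \<longrightarrow>
             (SUP \<theta>s \<in> B0 d k \<inter> B1 d R. worst_local_risk X \<sigma> \<rho> \<theta>s)
               \<ge> ennreal (?p / 128 * min (\<sigma>\<^sup>2) (\<sigma> * R / sqrt (real n)))) \<and>
          (\<forall>\<rho> \<in> separable_penalties d. convex_penalty d \<rho> \<longrightarrow>
             (SUP \<theta>s \<in> B0 d k \<inter> B1 d R. best_local_risk X \<sigma> \<rho> \<theta>s)
               \<ge> ennreal (?p / 128 * min (\<sigma>\<^sup>2) (\<sigma> * R / sqrt (real n))))"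
    using block_design_col_norm[OF n0 nd cs1] rate
      sup_worst_local_risk_ge[OF k] sup_best_local_risk_ge[OF k]
    by (intro bexI[of _ "block_design n d c s"]) (auto intro: order_trans)
qed

end
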